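(* Let $\delta \geq 2$ be an integer such that $\delta-1$ is a prime power. For integers $n$ and $g$, let $r(n,\delta,g)$ denote the maximum radius of a connected graph on $n$ vertices with minimum degree $\delta$ and girth at least $g$. Then: (i) there exist integers $n_i \to \infty$ such that $r(n_i,\delta,6) \geq \frac{3n_i}{2(\delta^2-\delta+1)}-3$; (ii) there exist integers $n_j \to \infty$ such that $r(n_j,\delta,8) \geq \frac{2n_j}{\delta^3-2\delta^2+2\delta}-4$; (iii) there exist integers $n_k \to \infty$ such that $r(n_k,\delta,12) \geq \frac{3n_k}{((\delta-1)^3+1)(\delta^2-\delta+1)}-6$.
   Context: Graphs are finite and simple. The girth of a graph is the length of its shortest cycle (infinite if acyclic). The radius of a connected graph $G$ is $\min_v \max_w d(v,w)$, with $d$ the graph distance. *)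

theory Defs
  imports
    "Graph_Theory.Graph_Theory"
    "HOL-Number_Theory.Prime_Powers"
    "HOL-Library.Extended_Nat"
begin

(* Simple graphs are represented by pair_graph: a finite vertex set with a symmetric, irreflexive
   set of arcs, so every edge uv occurs as the two arcs (u,v) and (v,u).  The degree of a vertex is
   its out-degree. *)

definition min_degree :: "'a pair_pre_digraph \<Rightarrow> nat" where
  "min_degree G = (MIN v\<in>pverts G. out_degree (with_proj G) v)"

(* The library's cycle admits the closed walk u,v,u of length 2 that runs along an edge and back;
   the bound on the length excludes it. *)
definition girth :: "'a pair_pre_digraph \<Rightarrow> enat" where
  "girth G = (INF p\<in>{p. pre_digraph.cycle (with_proj G) p \<and> 3 \<le> length p}. enat (length p))"

(* Meaningful only if v is reachable from u. *)
definition graph_dist :: "'a pair_pre_digraph \<Rightarrow> 'a \<Rightarrow> 'a \<Rightarrow> nat" where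
  "graph_dist G u v = (LEAST k. \<exists>p. pre_digraph.awalk (with_proj G) u p v \<and> length p = k)"

definition radius :: "'a pair_pre_digraph \<Rightarrow> nat" where
  "radius G = (MIN v\<in>pverts G. MAX w\<in>pverts G. graph_dist G v w)"

(* Every finite graph is isomorphic to one whose vertices are natural numbers. *)
definition radii :: "nat \<Rightarrow> nat \<Rightarrow> nat \<Rightarrow> nat set" where
  "radii n \<delta> g = {radius G | G :: nat pair_pre_digraph.
     pair_graph G \<and> Digraph_Component.connected (with_proj G) \<and> card (pverts G) = n \<and>
     min_degree G = \<delta> \<and> enat g \<le> girth G}"

(* Unspecified if no such graph exists. *)
definition max_radius :: "nat \<Rightarrow> nat \<Rightarrow> nat \<Rightarrow> nat" where
  "max_radius n \<delta> g = Max (radii n \<delta> g)"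

lemma graph_dist_less_card:
  assumes G: "pair_graph G" and conn: "Digraph_Component.connected (with_proj G)"
    and u: "u \<in> pverts G" and v: "v \<in> pverts G"
  shows "graph_dist G u v < card (pverts G)"
proof -
  interpret pair_graph G by (rule G)
  have "u \<rightarrow>\<^sup>*\<^bsub>with_proj G\<^esub> v"
    using conn u v by (auto simp: connected_def strongly_connected_def
        reachable_mk_symmetric_eq[OF sym_arcs])
  then obtain p where p: "apath u p v" by (auto simp: reachable_apath)
  then have w: "awalk u p v" and d: "distinct (pawalk_verts u p)"
    by (auto simp: apath_def)
  have "set (pawalk_verts u p) \<subseteq> pverts G"
    using w awalk_verts_in_verts[of u p] by (auto simp: awalk_def)
  then have "length (pawalk_verts u p) \<le> card (pverts G)"
    using d pair_finite_verts by (metis card_mono distinct_card)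
  moreover have "length (pawalk_verts u p) = Suc (length p)" by (induct p arbitrary: u) auto
  moreover have "graph_dist G u v \<le> length p"
    unfolding graph_dist_def by (rule Least_le) (use w in blast)
  ultimately show ?thesis by simp
qed

(* Hence the maximum in max_radius is attained as soon as radii n \<delta> g is nonempty. *)
lemma finite_radii: "finite (radii n \<delta> g)"
proof (rule finite_subset)
  show "radii n \<delta> g \<subseteq> {..n}"
  proof
    fix r assume "r \<in> radii n \<delta> g"
    then obtain G :: "nat pair_pre_digraph" where r: "r = radius G" and G: "pair_graph G"
      and c: "Digraph_Component.connected (with_proj G)" and n: "card (pverts G) = n"
      by (auto simp: radii_def)
    have fin: "finite (pverts G)"
      using G by (simp add: pair_graph_def pair_digraph_def pair_fin_digraph_def
          pair_fin_digraph_axioms_def)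
    obtain v where v: "v \<in> pverts G"
      using c by (auto simp: connected_def strongly_connected_def)
    have "(MAX w\<in>pverts G. graph_dist G v w) \<le> n"
      using fin v graph_dist_less_card[OF G c v] n by (subst Max_le_iff) (auto intro: less_imp_le)
    moreover have "radius G \<le> (MAX w\<in>pverts G. graph_dist G v w)"
      unfolding radius_def using fin v by (intro Min_le) auto
    ultimately show "r \<in> {..n}" using r by simp
  qed
qed simp

end

theory Submission
  imports "HOL-Algebra.Algebraic_Closure" "HOL-Number_Theory.Residues" Defs
begin

text \<open>
  Let \<open>q = \<delta> - 1\<close> and let \<open>H\<close> be the incidence graph of the projective plane \<open>PG(2,q)\<close>, of the symplectic
  quadrangle \<open>W(q)\<close> or of the split Cayley hexagon \<open>H(q)\<close>, with \<open>d = 3, 4, 6\<close> respectively: \<open>H\<close> is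
  \<open>\<delta>\<close>-regular, has girth at least \<open>2d\<close> and at most \<open>2M\<close> vertices, where \<open>M = 1 + q + \<dots> + q^(d-1)\<close>.
  Delete an edge \<open>uv\<close> from each of \<open>k\<close> copies of \<open>H\<close> and join \<open>v\<close> of each copy to \<open>u\<close> of the next one,
  cyclically.  The girth stays at least \<open>2d\<close>, and crossing a copy costs \<open>2d\<close> steps, so the graph
  maps 1-Lipschitz to a cycle of length \<open>2dk\<close> and its radius is at least \<open>dk - d\<close>.

  The three geometries are treated uniformly.  Points and lines are the images of a 1-space
  \<open>\<langle>b0\<rangle>\<close> and a 2-space \<open>\<langle>b0, b1\<rangle>\<close> under the linear maps that preserve a relation \<open>Z\<close> (no relation,
  a symplectic form being zero, a product of trace-zero octonions being zero).  As the graph is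
  edge-transitive, only cycles through the edge \<open>\<langle>b0\<rangle> - \<langle>b0, b1\<rangle>\<close> matter.  Positions of last nonzero
  coordinates are arranged on a \<open>d\<close>-cycle, a leading-term argument shows that the two positions
  occurring on a line are neighbours on it, and this gives a function that is 1-Lipschitz on all
  other edges and differs by \<open>2d - 1\<close> on that edge.
\<close>

section \<open>Girth and radius from Lipschitz functions\<close>

text \<open>The same integer function serves twice. It bounds every cycle through its exceptional
  edge from below; and in the cover, its jump \<open>2 * d - 1\<close> across the deleted edge
  \<open>uv\<close> plus 1 for the joining edge makes up the \<open>2 * d\<close> per copy, so it is
  also the potential that maps the cover to the long cycle. Hence no distance in the geometries is
  computed, and the axioms of a generalized polygon are not verified.

  Incidence is defined as the orbit of one flag, which makes transitivity automatic and reduces the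
  counting to one flag. The price is that neither connectedness nor the exact number of vertices
  comes with the definition. An upper bound on that number suffices, since smaller copies only
  improve the ratio of radius to order, and connectedness is obtained by passing to the component of
  \<open>u\<close>. It must then be excluded that \<open>uv\<close> is a bridge, for a copy would
  fall apart when the edge is rerouted; a count of edges between the two colour classes does
  this.\<close>

definition int_lipschitz :: "('a \<times> 'a) set \<Rightarrow> ('a \<Rightarrow> int) \<Rightarrow> bool" where
  "int_lipschitz E f \<longleftrightarrow> (\<forall>(a, b)\<in>E. \<bar>f a - f b\<bar> \<le> 1)"

lemma int_lipschitzI: "(\<And>a b. (a, b) \<in> E \<Longrightarrow> \<bar>f a - f b\<bar> \<le> 1) \<Longrightarrow> int_lipschitz E f"
  by (auto simp: int_lipschitz_def)

lemma int_lipschitzD: "int_lipschitz E f \<Longrightarrow> (a, b) \<in> E \<Longrightarrow> \<bar>f a - f b\<bar> \<le> 1"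
  by (auto simp: int_lipschitz_def)

(* The function f shows that a walk from x to y avoiding the edge xy has at least g - 1 steps. *)
definition girth_certified :: "nat \<Rightarrow> ('a \<times> 'a) set \<Rightarrow> bool" where
  "girth_certified g E \<longleftrightarrow> (\<forall>x y. (x, y) \<in> E \<longrightarrow>
     (\<exists>f. int_lipschitz (E - {(x, y), (y, x)}) f \<and> f y - f x = int g - 1))"

lemma pcas_lipschitz:
  assumes "pcas u p v" "set p \<subseteq> E" "int_lipschitz E f"
  shows "\<bar>f u - f v\<bar> \<le> int (length p)"
  using assms
proof (induction p arbitrary: u)
  case (Cons e p)
  obtain w where e: "e = (u, w)" using Cons.prems by (cases e) auto
  have "\<bar>f w - f v\<bar> \<le> int (length p)" using Cons e by auto
  moreover have "\<bar>f u - f w\<bar> \<le> 1" using Cons.prems e by (auto simp: int_lipschitz_def)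
  ultimately show ?case by simp
qed simp

lemma pcas_last_in_verts: "pcas u p v \<Longrightarrow> v \<in> set (pawalk_verts u p)"
  by (induction p arbitrary: u) auto

lemma pcas_fst_in_verts: "pcas u p v \<Longrightarrow> e \<in> set p \<Longrightarrow> fst e \<in> set (pawalk_verts u p)"
  by (induction p arbitrary: u) auto

lemma path_arc_tail_not_last:
  "pcas u p v \<Longrightarrow> distinct (pawalk_verts u p) \<Longrightarrow> e \<in> set p \<Longrightarrow> fst e \<noteq> v"
proof (induction p arbitrary: u)
  case (Cons a p)
  then show ?case using pcas_last_in_verts[of "snd a" p v] by auto
qed simp

text \<open>Meant for the reverse of the first arc of a cycle: the rest of the cycle is a path that
  could use it only by consisting of that arc alone, which length at least 3 excludes.\<close>

lemma path_closing_arc: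
  assumes "pcas u p v" "distinct (pawalk_verts u p)" "(u, v) \<in> set p"
  shows "length p = 1"
proof (cases p)
  case (Cons a q)
  have "a = (u, v)"
    using assms Cons pcas_fst_in_verts[of "snd a" q v "(u, v)"] by (cases a) auto
  moreover have "q = []"
  proof (cases q)
    case q: (Cons b r)
    then have "fst b \<noteq> v"
      using path_arc_tail_not_last[OF assms(1,2), of b] Cons by simp
    then show ?thesis using assms(1) Cons q \<open>a = (u, v)\<close> by simp
  qed
  ultimately show ?thesis using Cons by simp
qed (use assms in simp)

text \<open>Split off the first arc \<open>(u, w)\<close>; the rest is a path from \<open>w\<close>
  back to \<open>u\<close>. It avoids \<open>(u, w)\<close>, whose tail is the end of the path, and
  also \<open>(w, u)\<close>, so the certificate of this arc forces at least \<open>g - 1\<close>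
  further arcs.\<close>

lemma girth_certified_imp_girth_ge:
  assumes "girth_certified g (parcs G)"
  shows "enat g \<le> girth G"
  unfolding girth_def
proof (rule INF_greatest)
  fix p assume "p \<in> {p. pre_digraph.cycle (with_proj G) p \<and> 3 \<le> length p}"
  then obtain u where p: "set p \<subseteq> parcs G" "pcas u p u" "distinct (tl (pawalk_verts u p))"
    and len: "3 \<le> length p"
    by (auto simp: pre_digraph.cycle_def pre_digraph.awalk_def cas_with_proj_eq
        awalk_verts_with_proj_eq)
  obtain w q where pq: "p = (u, w) # q" using p(2) len by (cases p) auto
  have q: "pcas w q u" "distinct (pawalk_verts w q)" "(u, w) \<in> parcs G"
    using p pq by auto
  obtain f where f: "int_lipschitz (parcs G - {(u, w), (w, u)}) f" "f w - f u = int g - 1"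
    using assms q(3) by (auto simp: girth_certified_def)
  have "(u, w) \<notin> set q" using path_arc_tail_not_last[OF q(1,2)] by force
  moreover have "(w, u) \<notin> set q" using path_closing_arc[OF q(1,2)] len pq by auto
  ultimately have "\<bar>f w - f u\<bar> \<le> int (length q)"
    using p(1) pq by (intro pcas_lipschitz[OF q(1) _ f(1)]) auto
  then show "enat g \<le> enat (length p)" using f(2) pq by auto
qed

section \<open>From relations to graphs on natural numbers\<close>

lemma pcas_imp_relpow: "pcas u p v \<Longrightarrow> set p \<subseteq> E \<Longrightarrow> (u, v) \<in> E ^^ length p"
proof (induction p arbitrary: u)
  case (Cons a p)
  then have "(u, snd a) \<in> E" "(snd a, v) \<in> E ^^ length p" by (cases a; auto)+
  then show ?case by (metis length_Cons relpow_Suc_I2)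
qed simp

text \<open>The interface between the graph notions of the theorem and plain relations:
  eccentricities enter as bounds on exponents of relation powers and the girth as a certificate, so
  the constructions below need not speak of walks in a digraph.\<close>

lemma nat_graph_radius_in_radii:
  fixes R :: "(nat \<times> nat) set"
  assumes W: "finite W" "W \<noteq> {}" "R \<subseteq> W \<times> W" and R: "sym R" "irrefl R"
    and deg: "\<And>a. a \<in> W \<Longrightarrow> card (R `` {a}) = \<delta>"
    and conn: "\<And>a b. a \<in> W \<Longrightarrow> b \<in> W \<Longrightarrow> (a, b) \<in> R\<^sup>*"
    and girth: "girth_certified g R"
    and far: "\<And>a. a \<in> W \<Longrightarrow> \<exists>b\<in>W. \<forall>n. (a, b) \<in> R ^^ n \<longrightarrow> r \<le> n"
  shows "\<exists>\<rho>\<in>radii (card W) \<delta> g. r \<le> \<rho>"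
proof -
  define G where "G = \<lparr>pverts = W, parcs = R\<rparr>"
  have [simp]: "pverts G = W" "parcs G = R" by (auto simp: G_def)
  interpret G: pair_graph G
  proof
    show "finite (parcs G)" using W(1,3) by (simp add: finite_subset)
    show "symmetric (with_proj G)" using R(1) by (simp add: symmetric_def)
    show "fst e \<in> pverts G" "snd e \<in> pverts G" "fst e \<noteq> snd e" if "e \<in> parcs G" for e
      using that W(3) R(2) by (cases e; force simp: irrefl_def)+
  qed (use W in simp)
  have reach: "a \<rightarrow>\<^sup>*\<^bsub>with_proj G\<^esub> b" if "a \<in> W" "b \<in> W" for a b
    using that conn[OF that] by (simp add: G.reachable_conv)
  have connected: "Digraph_Component.connected (with_proj G)"
    using reach W(2) by (auto simp: connected_def strongly_connected_def
        G.reachable_mk_symmetric_eq[OF G.sym_arcs])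
  have "out_degree (with_proj G) a = \<delta>" if "a \<in> W" for a
  proof -
    have "out_arcs (with_proj G) a = Pair a ` (R `` {a})" by (auto simp: out_arcs_def)
    then show ?thesis
      using deg[OF that] by (simp add: out_degree_def card_image inj_on_def)
  qed
  then have "min_degree G = \<delta>"
    using W by (simp add: min_degree_def cong: image_cong_simp)
  moreover have "r \<le> radius G"
  proof -
    have "r \<le> (MAX w\<in>W. graph_dist G v w)" if v: "v \<in> W" for v
    proof -
      obtain w where w: "w \<in> W" "\<forall>n. (v, w) \<in> R ^^ n \<longrightarrow> r \<le> n" using far[OF v] by blast
      have "\<exists>k p. pre_digraph.awalk (with_proj G) v p w \<and> length p = k"
        using reach[OF v w(1)] by (auto simp: G.reachable_awalk)
      then have "\<exists>p. pre_digraph.awalk (with_proj G) v p w \<and> length p = graph_dist G v w"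
        unfolding graph_dist_def by (rule LeastI_ex)
      then have "r \<le> graph_dist G v w"
        using w(2) by (auto simp: pre_digraph.awalk_def cas_with_proj_eq dest: pcas_imp_relpow)
      then show ?thesis using w(1) W(1) by (meson Max_ge finite_imageI imageI order_trans)
    qed
    then show ?thesis using W by (auto simp: radius_def)
  qed
  moreover have "enat g \<le> girth G" using girth by (intro girth_certified_imp_girth_ge) simp
  ultimately show ?thesis
    using connected G.pair_graph_axioms by (auto simp: radii_def intro!: exI[of _ G])
qed

text \<open>Since \<open>radii\<close> ranges over graphs on natural numbers, the vertices are
  renumbered by an injection \<open>h\<close>. Certificates and walks are carried over by its
  inverse \<open>k\<close>.\<close>

lemma graph_radius_in_radii:
  fixes R :: "('a \<times> 'a) set"
  assumes W: "finite W" "W \<noteq> {}" "R \<subseteq> W \<times> W" and R: "sym R" "irrefl R"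
    and deg: "\<And>a. a \<in> W \<Longrightarrow> card (R `` {a}) = \<delta>"
    and conn: "\<And>a b. a \<in> W \<Longrightarrow> b \<in> W \<Longrightarrow> (a, b) \<in> R\<^sup>*"
    and girth: "girth_certified g R"
    and far: "\<And>a. a \<in> W \<Longrightarrow> \<exists>b\<in>W. \<forall>n. (a, b) \<in> R ^^ n \<longrightarrow> r \<le> n"
  shows "\<exists>\<rho>\<in>radii (card W) \<delta> g. r \<le> \<rho>"
proof -
  obtain h :: "'a \<Rightarrow> nat" where h: "inj_on h W"
    using finite_imp_inj_to_nat_seg[OF W(1)] by blast
  define k where "k = inv_into W h"
  define S where "S = map_prod h h ` R"
  have kh: "k (h a) = a" if "a \<in> W" for a using that h by (simp add: k_def)
  have SR: "(k a, k b) \<in> R" if "(a, b) \<in> S" for a b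
    using that W(3) by (auto simp: S_def kh)
  have hS: "(h a, h b) \<in> S" if "(a, b) \<in> R" for a b
    using that by (force simp: S_def)
  have S_iff: "(h a, h b) \<in> S \<longleftrightarrow> (a, b) \<in> R" if "a \<in> W" "b \<in> W" for a b
    using that SR[of "h a" "h b"] hS kh by auto
  have SW: "S \<subseteq> h ` W \<times> h ` W" using W(3) by (auto simp: S_def)
  have pow: "(k a, k b) \<in> R ^^ n" if "(a, b) \<in> S ^^ n" for a b n
    using that by (induction n arbitrary: b) (auto intro: SR)
  have "\<exists>\<rho>\<in>radii (card (h ` W)) \<delta> g. r \<le> \<rho>"
  proof (rule nat_graph_radius_in_radii)
    show "sym S" using R(1) by (auto simp: S_def sym_def)
    show "irrefl S" using R(2) SR by (auto simp: irrefl_def)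
    show "card (S `` {a}) = \<delta>" if a: "a \<in> h ` W" for a
    proof -
      obtain x where x: "a = h x" "x \<in> W" using a by blast
      have "S `` {a} = h ` (R `` {x})"
        using x W(3) S_iff[of x] SW by (auto simp: S_def dest: inj_onD[OF h])
      then show ?thesis using deg[OF x(2)] W(3) inj_on_subset[OF h]
        by (metis (no_types, lifting) Image_singleton_iff SigmaE2 card_image subsetD subsetI)
    qed
    show "(a, b) \<in> S\<^sup>*" if ab: "a \<in> h ` W" "b \<in> h ` W" for a b
    proof -
      obtain x y where xy: "a = h x" "x \<in> W" "b = h y" "y \<in> W" using ab by blast
      have "(h x, h y) \<in> S\<^sup>*" using conn[OF xy(2,4)]
        by (induction rule: rtrancl_induct) (auto dest: hS intro: rtrancl_into_rtrancl)
      then show ?thesis using xy by simp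
    qed
    show "girth_certified g S" unfolding girth_certified_def
    proof (intro allI impI)
      fix x y assume xy: "(x, y) \<in> S"
      then obtain f where f: "int_lipschitz (R - {(k x, k y), (k y, k x)}) f"
          "f (k y) - f (k x) = int g - 1"
        using girth SR by (fastforce simp: girth_certified_def)
      have "int_lipschitz (S - {(x, y), (y, x)}) (f \<circ> k)"
      proof (rule int_lipschitzI)
        fix a b assume "(a, b) \<in> S - {(x, y), (y, x)}"
        then have ab: "(a, b) \<in> S" "(a, b) \<notin> {(x, y), (y, x)}" by auto
        \<comment> \<open>Off the image of \<open>h\<close> the map \<open>k\<close> may fail to be
          injective. All four endpoints lie in the image, so an arc other than the deleted one stays
          different from it in \<open>R\<close>.\<close>
        have "h (k z) = z" if "z \<in> {a, b, x, y}" for z using that ab(1) xy SW kh by auto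
        then have "(k a, k b) \<notin> {(k x, k y), (k y, k x)}"
          using ab(2) by (simp, metis)
        then show "\<bar>(f \<circ> k) a - (f \<circ> k) b\<bar> \<le> 1"
          using SR[OF ab(1)] f(1) by (auto simp: int_lipschitz_def)
      qed
      then show "\<exists>f. int_lipschitz (S - {(x, y), (y, x)}) f \<and> f y - f x = int g - 1"
        using f(2) by (intro exI[of _ "f \<circ> k"]) simp
    qed
    show "\<exists>b\<in>h ` W. \<forall>n. (a, b) \<in> S ^^ n \<longrightarrow> r \<le> n" if a: "a \<in> h ` W" for a
    proof -
      obtain x where x: "a = h x" "x \<in> W" using a by blast
      obtain y where y: "y \<in> W" "\<forall>n. (x, y) \<in> R ^^ n \<longrightarrow> r \<le> n" using far[OF x(2)] by blast
      then have "\<forall>n. (h x, h y) \<in> S ^^ n \<longrightarrow> r \<le> n" using pow[of "h x" "h y"] kh x by auto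
      then show ?thesis using x y by auto
    qed
  qed (use W SW in auto)
  then show ?thesis using h by (simp add: card_image)
qed

section \<open>Cyclic covers\<close>

(* In the cover below, the edge uv of copy i is rerouted: it runs from v in copy i to u in copy i + 1. *)
definition shift :: "'a \<Rightarrow> 'a \<Rightarrow> 'a \<Rightarrow> 'a \<Rightarrow> int" where
  "shift u v x y = (if (x, y) = (v, u) then 1 else if (x, y) = (u, v) then - 1 else 0)"

text \<open>The lift of a voltage graph over the integers modulo \<open>k\<close>:
  \<open>shift\<close> is the voltage assignment, nonzero on the edge \<open>uv\<close>
  only.\<close>

definition cyclic_cover :: "int \<Rightarrow> 'a \<Rightarrow> 'a \<Rightarrow> ('a \<times> 'a) set \<Rightarrow> ((int \<times> 'a) \<times> (int \<times> 'a)) set" where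
  "cyclic_cover k u v E =
     {((i, x), (j, y)). (x, y) \<in> E \<and> i \<in> {0..<k} \<and> j = (i + shift u v x y) mod k}"

text \<open>On the cycle of length \<open>2 * d * k\<close>, the number \<open>s\<close> lies in the
  class of \<open>t\<close>, which is within \<open>d\<close> of the antipode \<open>d * k\<close>
  of 0. Every representative of such a class has absolute value at least
  \<open>d * k - d\<close>.\<close>

lemma dvd_in_window:
  fixes s t d k :: int
  assumes "2 * d * k dvd t - s" "d * k - d \<le> t" "t \<le> d * k + d" "0 \<le> d" "0 < k"
  shows "d * k - d \<le> \<bar>s\<bar>"
proof -
  obtain m where m: "t - s = 2 * d * k * m" using assms(1) by blast
  have dk: "0 \<le> d * k" using assms by simp
  consider "m \<le> 0" | "m \<ge> 1" by linarith
  then show ?thesis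
  proof cases
    case 1
    then have "2 * d * k * m \<le> 0" using dk by (simp add: mult_nonneg_nonpos)
    then show ?thesis using m assms by linarith
  next
    case 2
    then have "2 * (d * k) * 1 \<le> 2 * (d * k) * m" using dk by (intro mult_left_mono) auto
    then show ?thesis using m assms by (simp add: algebra_simps)
  qed
qed

text \<open>The assumption \<open>conn\<close> is stronger than connectedness: everything is
  reachable from \<open>u\<close> with the edge \<open>uv\<close> deleted, so each copy stays
  connected when that edge is rerouted.\<close>

locale edge_cyclic_cover =
  fixes C :: "'a set" and E :: "('a \<times> 'a) set" and u v :: 'a and d \<delta> :: nat and k :: int
  assumes C: "finite C" "E \<subseteq> C \<times> C" and E: "sym E" "irrefl E"
    and deg: "\<And>a. a \<in> C \<Longrightarrow> card (E `` {a}) = \<delta>"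
    and uv: "(u, v) \<in> E"
    and conn: "\<And>a. a \<in> C \<Longrightarrow> (u, a) \<in> (E - {(u, v), (v, u)})\<^sup>*"
    and girth: "girth_certified (2 * d) E"
    and k: "2 \<le> k" and d: "0 < d"
begin

abbreviation "R \<equiv> cyclic_cover k u v E"

lemma u_neq_v: "u \<noteq> v" using uv E by (auto simp: irrefl_def)

lemma vu: "(v, u) \<in> E" using uv E by (auto simp: sym_def)

lemma shift_swap: "shift u v y x = - shift u v x y"
  using u_neq_v by (auto simp: shift_def)

lemma R_iff: "((i, x), (j, y)) \<in> R \<longleftrightarrow>
  (x, y) \<in> E \<and> i \<in> {0..<k} \<and> j \<in> {0..<k} \<and> j = (i + shift u v x y) mod k"
  using k by (auto simp: cyclic_cover_def)

lemma R_sub: "R \<subseteq> ({0..<k} \<times> C) \<times> ({0..<k} \<times> C)"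
  using C(2) by (auto simp: R_iff)

lemma R_sym: "sym R"
proof (rule symI)
  fix a b assume ab: "(a, b) \<in> R"
  obtain i x j y where [simp]: "a = (i, x)" "b = (j, y)" by fastforce
  have i: "i \<in> {0..<k}" and j: "j \<in> {0..<k}" "j = (i + shift u v x y) mod k"
    and xy: "(x, y) \<in> E"
    using ab by (auto simp: R_iff)
  have "(j + shift u v y x) mod k = (i + shift u v x y + shift u v y x) mod k"
    by (simp add: j(2) mod_add_left_eq)
  also have "\<dots> = i" using i by (simp add: shift_swap[of y x])
  finally show "(b, a) \<in> R" using i j(1) symD[OF E(1) xy] by (simp add: R_iff)
qed

lemma R_irrefl: "irrefl R"
  using E(2) by (auto simp: R_iff irrefl_def)

lemma R_degree:
  assumes "a \<in> {0..<k} \<times> C"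
  shows "card (R `` {a}) = \<delta>"
proof -
  obtain i x where a: "a = (i, x)" "i \<in> {0..<k}" "x \<in> C" using assms by blast
  have "R `` {a} = (\<lambda>y. ((i + shift u v x y) mod k, y)) ` (E `` {x})"
    using a k by (auto simp: R_iff)
  then show ?thesis using deg[OF a(3)] by (simp add: card_image inj_on_def)
qed

lemma R_connected:
  assumes "a \<in> {0..<k} \<times> C" "b \<in> {0..<k} \<times> C"
  shows "(a, b) \<in> R\<^sup>*"
proof -
  have fibre: "((i, u), (i, x)) \<in> R\<^sup>*" if i: "i \<in> {0..<k}" and x: "x \<in> C" for i x
    using conn[OF x]
  proof (induction rule: rtrancl_induct)
    case (step y z)
    then have "((i, y), (i, z)) \<in> R" using i by (auto simp: R_iff shift_def)
    then show ?case using step.IH by simp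
  qed simp
  have root: "((0, u), (int n, u)) \<in> R\<^sup>*" if "int n < k" for n
    using that
  proof (induction n)
    case (Suc n)
    have "((int n, u), (int n, v)) \<in> R\<^sup>*" using Suc.prems C(2) uv by (intro fibre) auto
    moreover have "((int n, v), (int (Suc n), u)) \<in> R"
      using Suc.prems vu by (simp add: R_iff shift_def)
    ultimately show ?case using Suc by simp
  qed simp
  have "((0, u), c) \<in> R\<^sup>*" if c: "c \<in> {0..<k} \<times> C" for c
  proof -
    obtain i x where "c = (i, x)" "i \<in> {0..<k}" "x \<in> C" using c by blast
    then show ?thesis using root[of "nat i"] fibre[of i x] by simp
  qed
  then show ?thesis using assms sym_rtrancl[OF R_sym] by (meson rtrancl_trans symD)
qed

text \<open>As \<open>2 \<le> k\<close>, neither 1 nor -1 vanishes modulo \<open>k\<close>, so a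
  rerouted arc really leaves its copy.\<close>

lemma R_cases:
  assumes "((l, z), (m, w)) \<in> R"
  obtains (up) "z = v" "w = u" "m \<noteq> l" | (down) "z = u" "w = v" "m \<noteq> l"
    | (flat) "(z, w) \<notin> {(u, v), (v, u)}" "m = l"
proof -
  have l: "l \<in> {0..<k}" and m: "m = (l + shift u v z w) mod k" using assms by (auto simp: R_iff)
  have "k dvd s" if "(l + s) mod k = l" for s
    using that by (metis add_diff_cancel_left' mod_eq_dvd_iff mod_mod_trivial)
  from this[of 1] this[of "- 1"] have "(l + 1) mod k \<noteq> l" "(l + - 1) mod k \<noteq> l"
    using k by (auto simp: zdvd_not_zless)
  moreover have "l mod k = l" using l by simp
  ultimately show ?thesis using that m by (auto simp: shift_def split: if_splits)
qed

text \<open>With all other copies sent to \<open>u\<close>, the edge leaving copy \<open>i\<close>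
  at \<open>v\<close> lands on the edge \<open>vu\<close> of \<open>E\<close>, while the edge
  entering copy \<open>i\<close> at \<open>u\<close> is contracted to a point.\<close>

definition collapse :: "int \<Rightarrow> int \<times> 'a \<Rightarrow> 'a" where
  "collapse i c = (if fst c = i then snd c else u)"

text \<open>Assign every edge of the cover to one copy, a rerouted edge to the copy of its
  \<open>v\<close>-end; this is \<open>anchor\<close>. Collapsing onto a copy is faithful on the
  edges assigned to it (\<open>on\<close>) and contracts all others (\<open>off\<close>). So the
  certificate of an edge of \<open>E\<close> pulls back to each edge above it.\<close>

lemma R_girth: "girth_certified (2 * d) R"
  unfolding girth_certified_def
proof (intro allI impI)
  fix a b assume ab: "(a, b) \<in> R"
  obtain i x j y where [simp]: "a = (i, x)" "b = (j, y)" by fastforce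
  define anchor where "anchor l m z w = (if (z, w) = (u, v) then m else l)"
    for l m :: int and z w :: 'a
  define c where "c = anchor i j x y"
  have off: "collapse c (l, z) = collapse c (m, w)"
    if lm: "((l, z), (m, w)) \<in> R" "anchor l m z w \<noteq> c" for l m z w
    using lm(1) by (cases rule: R_cases) (use lm(2) u_neq_v in \<open>auto simp: collapse_def anchor_def\<close>)
  have on: "collapse c (l, z) = z \<and> collapse c (m, w) = w"
    if lm: "((l, z), (m, w)) \<in> R" "anchor l m z w = c" for l m z w
    using lm(1) by (cases rule: R_cases) (use lm(2) u_neq_v in \<open>auto simp: collapse_def anchor_def\<close>)
  \<comment> \<open>An arc of the cover is determined by its image in \<open>E\<close> and its
    anchor: within one class, nothing but the deleted arc lies over the deleted arc of
    \<open>E\<close>.\<close>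
  have det: "l = l' \<and> m = m'" if "((l, z), (m, w)) \<in> R" "((l', z), (m', w)) \<in> R"
      "anchor l m z w = anchor l' m' z w" for l m l' m' z w
  proof (cases "(z, w) = (u, v)")
    case True
    then show ?thesis
      using that symD[OF R_sym that(1)] symD[OF R_sym that(2)] by (auto simp: R_iff anchor_def)
  next
    case False
    then show ?thesis using that by (auto simp: R_iff anchor_def)
  qed
  have rev: "anchor m l w z = anchor l m z w" if "((l, z), (m, w)) \<in> R" for l m z w
    using that by (cases rule: R_cases) (use u_neq_v in \<open>auto simp: anchor_def\<close>)
  obtain f where f: "int_lipschitz (E - {(x, y), (y, x)}) f" "f y - f x = int (2 * d) - 1"
    using girth ab by (auto simp: girth_certified_def R_iff)
  have "int_lipschitz (R - {(a, b), (b, a)}) (f \<circ> collapse c)"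
  proof (rule int_lipschitzI)
    fix a' b' assume 0: "(a', b') \<in> R - {(a, b), (b, a)}"
    obtain l z m w where [simp]: "a' = (l, z)" "b' = (m, w)" by fastforce
    show "\<bar>(f \<circ> collapse c) a' - (f \<circ> collapse c) b'\<bar> \<le> 1"
    proof (cases "anchor l m z w = c")
      case True
      have "(z, w) \<noteq> (x, y)" using 0 True det[of l z m w i j] ab by (auto simp: c_def)
      moreover have "(z, w) \<noteq> (y, x)"
        using 0 True det[of l z m w j i] symD[OF R_sym ab] rev[of i x j y] ab by (auto simp: c_def)
      ultimately show ?thesis
        using on[of l z m w] True 0 f(1) by (auto simp: R_iff intro: int_lipschitzD)
    next
      case False
      then show ?thesis using off[of l z m w] 0 by simp
    qed
  qed
  moreover have "collapse c a = x" "collapse c b = y"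
    using on[of i x j y] ab by (auto simp: c_def)
  ultimately show "\<exists>f. int_lipschitz (R - {(a, b), (b, a)}) f \<and> f b - f a = int (2 * d) - 1"
    using f(2) by (intro exI[of _ "f \<circ> collapse c"]) simp
qed

text \<open>Up to multiples of \<open>2 * d * k\<close>, the potential \<open>F\<close> changes by
  at most 1 along an arc, so a walk of \<open>n\<close> steps changes it by at most
  \<open>n\<close>. A vertex whose value is nearly antipodal to that of \<open>a\<close> is
  therefore far from \<open>a\<close>.\<close>

lemma R_far:
  assumes "a \<in> {0..<k} \<times> C"
  shows "\<exists>b\<in>{0..<k} \<times> C. \<forall>n. (a, b) \<in> R ^^ n \<longrightarrow> d * nat (k - 1) \<le> n"
proof -
  obtain f where f: "int_lipschitz (E - {(u, v), (v, u)}) f" "f v - f u = int (2 * d) - 1"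
    using girth uv by (auto simp: girth_certified_def)
  define g where "g = 2 * int d"
  \<comment> \<open>From \<open>v\<close> in one copy to \<open>u\<close> in the next,
    \<open>F\<close> grows by \<open>g + f u - f v = 2 * d - (2 * d - 1) = 1\<close>. This is where
    the exact jump of the certificate is used.\<close>
  define F where "F c = g * fst c + f (snd c) - f u" for c :: "int \<times> 'a"
  have step: "\<exists>s. \<bar>s\<bar> \<le> 1 \<and> g * k dvd F c' - F c - s" if cc: "(c, c') \<in> R" for c c'
  proof -
    obtain i x j y where [simp]: "c = (i, x)" "c' = (j, y)" by fastforce
    have "k dvd j - (i + shift u v x y)"
      using cc by (metis R_iff \<open>c = (i, x)\<close> \<open>c' = (j, y)\<close> mod_eq_dvd_iff mod_mod_trivial)
    then have dvd: "g * k dvd g * j - g * (i + shift u v x y)"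
      by (metis mult_dvd_mono dvd_refl right_diff_distrib')
    consider "(x, y) = (v, u)" | "(x, y) = (u, v)" | "(x, y) \<in> E - {(u, v), (v, u)}"
      using cc by (auto simp: R_iff)
    then show ?thesis
    proof cases
      case 1
      then have "g * j - g * (i + shift u v x y) = F c' - F c - 1"
        using f(2) by (simp add: F_def shift_def g_def algebra_simps)
      then show ?thesis using dvd by (intro exI[of _ 1]) simp
    next
      case 2
      then have "g * j - g * (i + shift u v x y) = F c' - F c - (- 1)"
        using f(2) u_neq_v by (simp add: F_def shift_def g_def algebra_simps)
      then show ?thesis using dvd by (intro exI[of _ "- 1"]) simp
    next
      case 3
      then have "\<bar>f y - f x\<bar> \<le> 1" using int_lipschitzD[OF f(1) 3] by simp
      moreover have "g * j - g * (i + shift u v x y) = F c' - F c - (f y - f x)"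
        using 3 by (auto simp: F_def shift_def)
      ultimately show ?thesis using dvd by (intro exI[of _ "f y - f x"]) simp
    qed
  qed
  have walk: "\<exists>s. \<bar>s\<bar> \<le> int n \<and> g * k dvd F c' - F c - s" if "(c, c') \<in> R ^^ n" for c c' n
    using that
  proof (induction n arbitrary: c')
    case (Suc n)
    then obtain w where w: "(c, w) \<in> R ^^ n" "(w, c') \<in> R" by auto
    obtain s where s: "\<bar>s\<bar> \<le> int n" "g * k dvd F w - F c - s" using Suc.IH[OF w(1)] by blast
    obtain t where t: "\<bar>t\<bar> \<le> 1" "g * k dvd F c' - F w - t" using step[OF w(2)] by blast
    have "g * k dvd (F w - F c - s) + (F c' - F w - t)" using s(2) t(2) by (rule dvd_add)
    then have "g * k dvd F c' - F c - (s + t)" by (simp add: algebra_simps)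
    then show ?case using s(1) t(1) by (intro exI[of _ "s + t"]) auto
  qed auto
  \<comment> \<open>The copies of \<open>u\<close> have the multiples of \<open>g = 2 * d\<close> as
    values. The added \<open>d\<close> turns the floor into rounding, so \<open>g * j\<close> lies
    within \<open>d\<close> of the antipodal value \<open>F a + d * k\<close>; reducing
    \<open>j\<close> modulo \<open>k\<close> changes it by a multiple of
    \<open>g * k\<close>.\<close>
  define j where "j = (F a + int d * k + int d) div g"
  have g: "0 < g" using d by (simp add: g_def)
  define b where "b = (j mod k, u)"
  have b: "b \<in> {0..<k} \<times> C" using k C(2) uv by (auto simp: b_def)
  have j: "int d * k - int d \<le> g * j - F a" "g * j - F a \<le> int d * k + int d"
    using minus_mod_eq_mult_div[of "F a + int d * k + int d" g] g_def
      pos_mod_bound[OF g, of "F a + int d * k + int d"] pos_mod_sign[OF g, of "F a + int d * k + int d"]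
    unfolding j_def by linarith+
  have "d * nat (k - 1) \<le> n" if ab: "(a, b) \<in> R ^^ n" for n
  proof -
    obtain s where s: "\<bar>s\<bar> \<le> int n" "g * k dvd F b - F a - s" using walk[OF ab] by blast
    have "g * k dvd g * (j - j mod k)"
      by (intro mult_dvd_mono) (auto simp: minus_mod_eq_mult_div)
    then have "g * k dvd (F b - F a - s) + g * (j - j mod k)" using s(2) by (rule dvd_add[rotated])
    moreover have "(F b - F a - s) + g * (j - j mod k) = (g * j - F a) - s"
      by (simp add: F_def b_def algebra_simps)
    ultimately have "2 * int d * k dvd (g * j - F a) - s" by (metis g_def)
    then have "int d * k - int d \<le> \<bar>s\<bar>"
      using j k by (intro dvd_in_window[where t = "g * j - F a"]) auto
    then have "int d * (k - 1) \<le> int n" using s(1) by (simp add: algebra_simps)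
    moreover have "int (d * nat (k - 1)) = int d * (k - 1)" using k by simp
    ultimately show ?thesis by linarith
  qed
  then show ?thesis using b by blast
qed

lemma radius_of_cover:
  "\<exists>\<rho>\<in>radii (nat k * card C) \<delta> (2 * d). d * nat (k - 1) \<le> \<rho>"
proof -
  have "\<exists>\<rho>\<in>radii (card ({0..<k} \<times> C)) \<delta> (2 * d). d * nat (k - 1) \<le> \<rho>"
    using C R_sub R_sym R_irrefl R_degree R_connected R_girth R_far k uv
    by (intro graph_radius_in_radii[where R = R]) auto
  then show ?thesis by (simp add: card_cartesian_product)
qed

end

section \<open>Regular bipartite graphs and their components\<close>

lemma girth_certified_subset:
  assumes "girth_certified g E" "D \<subseteq> E"
  shows "girth_certified g D"
  unfolding girth_certified_def
proof (intro allI impI)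
  fix x y assume "(x, y) \<in> D"
  then obtain f where "int_lipschitz (E - {(x, y), (y, x)}) f" "f y - f x = int g - 1"
    using assms unfolding girth_certified_def by blast
  moreover from this have "int_lipschitz (D - {(x, y), (y, x)}) f"
    using assms(2) by (auto simp: int_lipschitz_def)
  ultimately show "\<exists>f. int_lipschitz (D - {(x, y), (y, x)}) f \<and> f y - f x = int g - 1" by blast
qed

(* Otherwise the component of u would have \<delta> |A| - 1 = \<delta> |B| edges, A and B being its colour classes. *)
lemma regular_bipartite_no_bridge:
  fixes E :: "('a \<times> 'a) set" and col :: "'a \<Rightarrow> bool"
  assumes V: "finite V" "E \<subseteq> V \<times> V" and E: "sym E" and uv: "(u, v) \<in> E"
    and col: "\<And>a b. (a, b) \<in> E \<Longrightarrow> col a \<noteq> col b"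
    and deg: "\<And>a. a \<in> V \<Longrightarrow> card (E `` {a}) = \<delta>" and \<delta>: "2 \<le> \<delta>"
  shows "(u, v) \<in> (E - {(u, v), (v, u)})\<^sup>*"
proof (rule ccontr)
  define D where "D = E - {(u, v), (v, u)}"
  assume "(u, v) \<notin> (E - {(u, v), (v, u)})\<^sup>*"
  then have v: "(u, v) \<notin> D\<^sup>*" by (simp add: D_def)
  define A where "A = {a. (u, a) \<in> D\<^sup>* \<and> col a = col u}"
  define B where "B = {b. (u, b) \<in> D\<^sup>* \<and> col b \<noteq> col u}"
  have reachV: "a \<in> V" if "(u, a) \<in> D\<^sup>*" for a
    using that by (cases rule: rtranclE) (use V uv in \<open>auto simp: D_def\<close>)
  have AB: "A \<subseteq> V" "B \<subseteq> V" using reachV by (auto simp: A_def B_def)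
  then have fin: "finite A" "finite B" using V(1) finite_subset by blast+
  have finE: "finite (E `` {a})" for a using V by (rule_tac finite_subset[of _ V]) auto
  have D_sym: "(b, a) \<in> D" if "(a, b) \<in> D" for a b using that E by (auto simp: D_def sym_def)
  have D_col: "col a \<noteq> col b" if "(a, b) \<in> D" for a b using that col by (auto simp: D_def)
  have D_iff: "a \<in> A \<and> (a, b) \<in> D \<longleftrightarrow> b \<in> B \<and> (b, a) \<in> D" for a b
    using D_sym[of a b] D_sym[of b a] D_col[of a b]
    by (auto simp: A_def B_def intro: rtrancl_into_rtrancl)
  have uA: "u \<in> A" by (simp add: A_def)
  \<comment> \<open>Since \<open>v\<close> is unreachable, \<open>u\<close> is the only vertex of
    its component that has lost a neighbour.\<close>
  have "D `` {b} = E `` {b}" if "b \<in> B" for b using that v by (auto simp: D_def B_def)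
  then have degB: "card (D `` {b}) = \<delta>" if "b \<in> B" for b using that deg AB by auto
  have "D `` {a} = E `` {a}" if "a \<in> A - {u}" for a using that v by (auto simp: D_def A_def)
  then have degA: "card (D `` {a}) = \<delta>" if "a \<in> A - {u}" for a using that deg AB by auto
  have "u \<noteq> v" using col[OF uv] by auto
  then have "D `` {u} = E `` {u} - {v}" by (auto simp: D_def)
  then have degu: "card (D `` {u}) = \<delta> - 1" using deg[of u] AB uA uv finE by auto
  have finD: "finite (D `` {a})" for a using finE[of a] by (rule finite_subset[rotated]) (auto simp: D_def)
  have "card (SIGMA a:A. D `` {a}) = (\<Sum>a\<in>A. card (D `` {a}))"
    using fin finD by (simp add: card_SigmaI)
  also have "\<dots> = (\<delta> - 1) + (\<Sum>a\<in>A - {u}. card (D `` {a}))"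
    using fin uA degu by (simp add: sum.remove)
  also have "\<dots> = (\<delta> - 1) + card (A - {u}) * \<delta>" using degA by simp
  finally have 1: "card (SIGMA a:A. D `` {a}) = (\<delta> - 1) + card (A - {u}) * \<delta>" .
  have "(SIGMA a:A. D `` {a}) = prod.swap ` (SIGMA b:B. D `` {b})"
    unfolding image_iff set_eq_iff by (auto; metis D_iff)
  then have "card (SIGMA a:A. D `` {a}) = card (SIGMA b:B. D `` {b})"
    by (simp add: card_image)
  also have "\<dots> = (\<Sum>b\<in>B. card (D `` {b}))" using fin finD by (simp add: card_SigmaI)
  also have "\<dots> = card B * \<delta>" using degB by simp
  finally have "(\<delta> - 1) + card (A - {u}) * \<delta> = card B * \<delta>" using 1 by simp
  then have "\<delta> dvd (\<delta> - 1) + card (A - {u}) * \<delta>" by simp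
  then have "\<delta> dvd \<delta> - 1" by (metis dvd_add_left_iff dvd_triv_right)
  then show False using \<delta> by (auto dest: dvd_imp_le)
qed

text \<open>With \<open>k\<close> copies of a component of at most \<open>2 * M\<close> vertices,
  the order is \<open>n \<le> 2 * M * k\<close> and the radius at least \<open>d * (k - 1)\<close>,
  which is at least \<open>d * n / (2 * M) - d\<close>.\<close>

lemma long_radius_family:
  fixes E :: "('a \<times> 'a) set" and col :: "'a \<Rightarrow> bool"
  assumes V: "finite V" "E \<subseteq> V \<times> V" and E: "sym E" and uv: "(u, v) \<in> E"
    and col: "\<And>a b. (a, b) \<in> E \<Longrightarrow> col a \<noteq> col b"
    and deg: "\<And>a. a \<in> V \<Longrightarrow> card (E `` {a}) = \<delta>" and \<delta>: "2 \<le> \<delta>"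
    and girth: "girth_certified (2 * d) E" and d: "0 < d" and M: "card V \<le> 2 * M"
  shows "\<exists>n :: nat \<Rightarrow> nat. filterlim n at_top sequentially \<and>
    (\<forall>i. radii (n i) \<delta> (2 * d) \<noteq> {} \<and>
       real (max_radius (n i) \<delta> (2 * d)) \<ge> real d * real (n i) / (2 * real M) - real d)"
proof -
  define D where "D = E - {(u, v), (v, u)}"
  define C where "C = {a. (u, a) \<in> D\<^sup>*}"
  have uC: "u \<in> C" by (simp add: C_def)
  have vC: "v \<in> C"
    using regular_bipartite_no_bridge[OF V E uv col deg \<delta>] by (simp add: C_def D_def)
  have CV: "C \<subseteq> V"
  proof
    fix a assume "a \<in> C"
    then have "(u, a) \<in> D\<^sup>*" by (simp add: C_def)
    then show "a \<in> V" by (cases rule: rtranclE) (use V uv in \<open>auto simp: D_def\<close>)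
  qed
  \<comment> \<open>Because the deleted edge is no bridge, both its ends lie in \<open>C\<close>. So
    \<open>C\<close> is closed under all of \<open>E\<close>, and degrees do not drop on restriction
    to it.\<close>
  have closed: "b \<in> C" if "a \<in> C" "(a, b) \<in> E" for a b
    using that uC vC by (cases "(a, b) \<in> D") (auto simp: C_def D_def intro: rtrancl_into_rtrancl)
  define EC where "EC = E \<inter> C \<times> C"
  have cover: "edge_cyclic_cover C EC u v d \<delta> k" if "2 \<le> k" for k
  proof
    show "finite C" using CV V(1) finite_subset by blast
    show "sym EC" using E by (auto simp: EC_def sym_def)
    show "irrefl EC" using col by (auto simp: EC_def irrefl_def)
    show "girth_certified (2 * d) EC" using girth by (rule girth_certified_subset) (auto simp: EC_def)
    show "card (EC `` {a}) = \<delta>" if "a \<in> C" for a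
    proof -
      have "EC `` {a} = E `` {a}" using that closed by (auto simp: EC_def)
      then show ?thesis using deg[of a] that CV by auto
    qed
    show "(u, a) \<in> (EC - {(u, v), (v, u)})\<^sup>*" if a: "a \<in> C" for a
    proof -
      have "(u, a) \<in> D\<^sup>*" using a by (simp add: C_def)
      then show ?thesis
      proof (induction rule: rtrancl_induct)
        case (step y z)
        then have "(y, z) \<in> EC - {(u, v), (v, u)}"
          by (auto simp: EC_def D_def C_def intro: rtrancl_into_rtrancl)
        with step.IH show ?case by (rule rtrancl_into_rtrancl)
      qed simp
    qed
  qed (use d that uv uC vC in \<open>auto simp: EC_def\<close>)
  have finC: "finite C" using CV V(1) finite_subset by blast
  then have C: "0 < card C" "card C \<le> 2 * M"
    using uC CV V(1) M by (auto simp: card_gt_0_iff intro: order_trans card_mono)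
  \<comment> \<open>The family starts with two copies, the smallest number the cover admits.\<close>
  define n where "n i = (i + 2) * card C" for i
  have "i \<le> n i" for i using C(1) by (cases "card C") (auto simp: n_def)
  then have "filterlim n at_top sequentially"
    by (intro filterlim_at_top_mono[OF filterlim_ident]) auto
  moreover have "radii (n i) \<delta> (2 * d) \<noteq> {} \<and>
      real (max_radius (n i) \<delta> (2 * d)) \<ge> real d * real (n i) / (2 * real M) - real d" for i
  proof -
    have k: "2 \<le> int (i + 2)" "nat (int (i + 2)) = i + 2" "nat (int (i + 2) - 1) = i + 1" by auto
    obtain \<rho> where \<rho>: "\<rho> \<in> radii (n i) \<delta> (2 * d)" "d * (i + 1) \<le> \<rho>"
      using edge_cyclic_cover.radius_of_cover[OF cover[OF k(1)]] unfolding k n_def by blast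
    then have "d * (i + 1) \<le> max_radius (n i) \<delta> (2 * d)"
      unfolding max_radius_def using finite_radii by (meson Max_ge order_trans)
    then have "real d * real (i + 1) \<le> real (max_radius (n i) \<delta> (2 * d))"
      by (metis of_nat_le_iff of_nat_mult)
    moreover have "real d * real (n i) / (2 * real M) \<le> real d * real (i + 2)"
    proof -
      have "real (card C) \<le> 2 * real M" using C(2) by linarith
      moreover from this have "0 < 2 * real M" using C(1) by linarith
      ultimately have "real (i + 2) * real (card C) / (2 * real M) \<le> real (i + 2)"
        by (subst pos_divide_le_eq) (auto intro!: mult_left_mono simp del: of_nat_add)
      then have "real d * (real (i + 2) * real (card C) / (2 * real M)) \<le> real d * real (i + 2)"
        by (intro mult_left_mono) auto
      then show ?thesis by (simp only: n_def of_nat_mult times_divide_eq_right)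
    qed
    ultimately show ?thesis using \<rho>(1) by (auto simp: algebra_simps)
  qed
  ultimately show ?thesis by blast
qed

section \<open>Finite fields\<close>

lemma (in cring) binomial_expansion:
  assumes x: "x \<in> carrier R" and y: "y \<in> carrier R"
  shows "(x \<oplus> y) [^] (n :: nat) =
    (\<Oplus>k\<in>{..n}. [(n choose k)] \<cdot> (x [^] k \<otimes> y [^] (n - k)))"
proof (induction n)
  case 0
  then show ?case using x y by simp
next
  case (Suc n)
  define t where "t m k = x [^] (k :: nat) \<otimes> y [^] (m - k)" for m k :: nat
  have t: "t m k \<in> carrier R" for m k using x y by (simp add: t_def)
  have tx: "t n k \<otimes> x = t (Suc n) (Suc k)" if "k \<le> n" for k
    using x y by (simp add: t_def m_ac)
  have ty: "t n k \<otimes> y = t (Suc n) k" if "k \<le> n" for k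
    using x y that by (simp add: t_def m_ac Suc_diff_le)
  define S where "S = (\<Oplus>k\<in>{..n}. [(n choose k)] \<cdot> t n k)"
  have S: "S \<in> carrier R" using t by (simp add: S_def)
  have Sx: "S \<otimes> x = (\<Oplus>k\<in>{..n}. [(n choose k)] \<cdot> t (Suc n) (Suc k))"
    unfolding S_def using t x
    by (subst finsum_ldistr) (auto intro!: add.finprod_cong' simp: add_pow_ldistr tx)
  have "S \<otimes> y = (\<Oplus>k\<in>{..n}. [(n choose k)] \<cdot> t (Suc n) k)"
    unfolding S_def using t y
    by (subst finsum_ldistr) (auto intro!: add.finprod_cong' simp: add_pow_ldistr ty)
  also have "\<dots> = (\<Oplus>k\<in>{..Suc n}. [(n choose k)] \<cdot> t (Suc n) k)"
    using t by (subst finsum_Suc) (auto simp: binomial_eq_0)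
  also have "\<dots> = (\<Oplus>k\<in>{..n}. [(n choose Suc k)] \<cdot> t (Suc n) (Suc k)) \<oplus> [(n choose 0)] \<cdot> t (Suc n) 0"
    using t by (subst finsum_Suc2) auto
  finally have Sy: "S \<otimes> y =
    (\<Oplus>k\<in>{..n}. [(n choose Suc k)] \<cdot> t (Suc n) (Suc k)) \<oplus> [(n choose 0)] \<cdot> t (Suc n) 0" .
  have "(x \<oplus> y) [^] Suc n = S \<otimes> x \<oplus> S \<otimes> y"
    using Suc.IH x y S by (simp add: S_def[symmetric] t_def[symmetric] r_distr)
  also have "\<dots> = ((\<Oplus>k\<in>{..n}. [(n choose k)] \<cdot> t (Suc n) (Suc k)) \<oplus>
      (\<Oplus>k\<in>{..n}. [(n choose Suc k)] \<cdot> t (Suc n) (Suc k))) \<oplus> [(n choose 0)] \<cdot> t (Suc n) 0"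
    unfolding Sx Sy using t by (simp add: a_assoc)
  also have "\<dots> = (\<Oplus>k\<in>{..n}. [(Suc n choose Suc k)] \<cdot> t (Suc n) (Suc k)) \<oplus> [(Suc n choose 0)] \<cdot> t (Suc n) 0"
    using t by (subst finsum_addf[symmetric]) (auto simp: add.nat_pow_mult)
  also have "\<dots> = (\<Oplus>k\<in>{..Suc n}. [(Suc n choose k)] \<cdot> t (Suc n) k)"
    using t by (subst finsum_Suc2) auto
  finally show ?case by (simp only: t_def)
qed

text \<open>For exponent \<open>p\<close> the inner binomial coefficients are multiples of
  \<open>p\<close> and vanish in the ring; iterating gives the powers of \<open>p\<close>.\<close>

lemma (in cring) freshmans_dream:
  fixes p :: nat
  assumes p: "prime p" and char: "[p] \<cdot> \<one> = \<zero>" and x: "x \<in> carrier R" and y: "y \<in> carrier R"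
  shows "(x \<oplus> y) [^] (p ^ m) = x [^] (p ^ m) \<oplus> y [^] (p ^ m)"
proof (induction m)
  case 0
  then show ?case using x y by (simp add: nat_pow_eone)
next
  case (Suc m)
  have kill: "[c] \<cdot> z = \<zero>" if z: "z \<in> carrier R" and c: "p dvd c" for c z
  proof -
    obtain e where e: "c = p * e" using c by blast
    have "[p] \<cdot> ([e] \<cdot> z) = ([p] \<cdot> \<one>) \<otimes> ([e] \<cdot> z)" using z by (simp add: add_pow_ldistr)
    then have "[p] \<cdot> ([e] \<cdot> z) = \<zero>" using z char by simp
    then show ?thesis using z by (simp add: e add.nat_pow_pow mult.commute)
  qed
  have frob: "(a \<oplus> b) [^] p = a [^] p \<oplus> b [^] p" if a: "a \<in> carrier R" and b: "b \<in> carrier R" for a b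
  proof -
    obtain r where r: "p = Suc (Suc r)" using prime_ge_2_nat[OF p] by (metis add_2_eq_Suc le_Suc_ex)
    define t where "t k = [(p choose k)] \<cdot> (a [^] k \<otimes> b [^] (p - k))" for k
    have t: "t k \<in> carrier R" for k using a b by (simp add: t_def)
    have mid: "t (Suc k) = \<zero>" if "k \<le> r" for k
      unfolding t_def using a b that p r by (intro kill dvd_choose_prime) auto
    have "(a \<oplus> b) [^] p = (\<Oplus>k\<in>{..Suc (Suc r)}. t k)"
      using binomial_expansion[OF a b, of p] by (simp add: t_def r)
    also have "\<dots> = t (Suc (Suc r)) \<oplus> ((\<Oplus>k\<in>{..r}. t (Suc k)) \<oplus> t 0)"
      using t by (subst finsum_Suc, simp, subst finsum_Suc2) auto
    also have "(\<Oplus>k\<in>{..r}. t (Suc k)) = \<zero>"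
      using mid by (intro add.finprod_one_eqI) auto
    also have "t (Suc (Suc r)) \<oplus> (\<zero> \<oplus> t 0) = a [^] p \<oplus> b [^] p"
      using a b by (simp add: t_def r[symmetric])
    finally show ?thesis .
  qed
  have "(x \<oplus> y) [^] (p ^ Suc m) = ((x \<oplus> y) [^] (p ^ m)) [^] p"
    using x y by (simp add: nat_pow_pow mult.commute)
  also have "\<dots> = (x [^] (p ^ m)) [^] p \<oplus> (y [^] (p ^ m)) [^] p"
    using x y by (simp add: Suc.IH frob)
  finally show ?case using x y by (simp add: nat_pow_pow mult.commute)
qed


text \<open>Additivity applied to \<open>- x\<close> and \<open>x\<close>; this avoids a case
  distinction on the parity of \<open>p\<close>.\<close>

lemma (in cring) freshmans_dream_minus:
  fixes p :: nat
  assumes "prime p" "[p] \<cdot> \<one> = \<zero>" "x \<in> carrier R"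
  shows "(\<ominus> x) [^] (p ^ m) = \<ominus> (x [^] (p ^ m))"
proof -
  have "(\<ominus> x) [^] (p ^ m) \<oplus> x [^] (p ^ m) = (\<ominus> x \<oplus> x) [^] (p ^ m)"
    using assms freshmans_dream[of p "\<ominus> x" x m] by simp
  also have "\<dots> = \<zero>" using assms by (simp add: l_neg nat_pow_zero prime_gt_0_nat)
  finally show ?thesis using assms by (intro minus_equality[symmetric]) auto
qed

text \<open>The fixed elements are the roots of \<open>P = X^q - X\<close>, which splits, so only
  simplicity of the roots is at stake. Instead of a derivative, put \<open>Y = X - a\<close> for a
  root \<open>a\<close>: Frobenius gives \<open>P = Y^q - Y\<close>, so if \<open>Y^2\<close>
  divided \<open>P\<close>, cancelling one factor \<open>Y\<close> would make \<open>Y\<close> a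
  unit.\<close>

lemma (in algebraically_closed) card_frobenius_fixed:
  fixes p m :: nat
  assumes p: "prime p" and m: "0 < m" and char: "[p] \<cdot> \<one> = \<zero>"
  shows "card {a \<in> carrier L. a [^] (p ^ m) = a} = p ^ m"
proof -
  define q where "q = p ^ m"
  have q2: "2 \<le> q" using p m unfolding q_def
    by (metis One_nat_def Suc_leI le_trans power_increasing power_one_right prime_ge_1_nat prime_ge_2_nat)
  interpret UP: domain "poly_ring L" using univ_poly_is_domain[OF carrier_is_subring] .
  interpret const: ring_hom_ring L "poly_ring L" poly_of_const
    using canonical_embedding_ring_hom[OF carrier_is_subring] by simp
  have X: "X \<in> carrier (poly_ring L)" using var_closed[OF carrier_is_subring] by simp
  define P where "P = X [^]\<^bsub>poly_ring L\<^esub> q \<ominus>\<^bsub>poly_ring L\<^esub> X"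
  have P: "P \<in> carrier (poly_ring L)" using X by (simp add: P_def)
  have pow: "X [^]\<^bsub>poly_ring L\<^esub> q = \<one> # replicate q \<zero>"
    using unitary_monom_eq_var_pow[OF carrier_is_subring, of q] by (simp add: monom_def)
  have degX: "degree (\<ominus>\<^bsub>poly_ring L\<^esub> X) = 1"
    using univ_poly_a_inv_degree[OF carrier_is_subring X] by (simp add: var_def)
  have "degree P = q"
  proof -
    have "polynomial (carrier L) (X [^]\<^bsub>poly_ring L\<^esub> q)" "polynomial (carrier L) (\<ominus>\<^bsub>poly_ring L\<^esub> X)"
      using X by (simp_all add: univ_poly_carrier)
    then have "degree (poly_add (X [^]\<^bsub>poly_ring L\<^esub> q) (\<ominus>\<^bsub>poly_ring L\<^esub> X)) = max q 1"
      using q2 degX pow by (subst poly_add_degree_eq[OF carrier_is_subring]) auto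
    then show ?thesis using q2 by (simp add: P_def a_minus_def univ_poly_add)
  qed
  then have P0: "P \<noteq> []" using q2 by auto
  have root: "is_root P a \<longleftrightarrow> a \<in> carrier L \<and> a [^] q = a" for a
  proof (cases "a \<in> carrier L")
    case True
    interpret ev: ring_hom_ring "poly_ring L" L "\<lambda>p. eval p a"
      using eval_ring_hom[OF carrier_is_subring True] .
    have "eval P a = a [^] q \<ominus> a"
      using X True by (simp add: P_def a_minus_def ev.hom_nat_pow eval_var)
    then show ?thesis using True P0 by (auto simp: is_root_def)
  qed (simp add: is_root_def)
  have pol_char: "[p] \<cdot>\<^bsub>poly_ring L\<^esub> \<one>\<^bsub>poly_ring L\<^esub> = \<zero>\<^bsub>poly_ring L\<^esub>"
  proof -
    have "poly_of_const ([n] \<cdot> \<one>) = [n] \<cdot>\<^bsub>poly_ring L\<^esub> \<one>\<^bsub>poly_ring L\<^esub>" for n :: nat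
      by (induction n) auto
    then show ?thesis using char by (metis const.hom_zero)
  qed
  have simple: "alg_mult P a \<le> 1" if a: "a \<in> carrier L" "a [^] q = a" for a
  proof (rule ccontr)
    assume "\<not> alg_mult P a \<le> 1"
    define Y where "Y = [\<one>, \<ominus> a]"
    define A where "A = poly_of_const a"
    have Y: "Y \<in> carrier (poly_ring L)"
      using a by (auto simp: Y_def univ_poly_carrier[symmetric] polynomial_def)
    have A: "A \<in> carrier (poly_ring L)" using a by (simp add: A_def)
    have XYA: "Y = X \<ominus>\<^bsub>poly_ring L\<^esub> A"
    proof -
      have "X \<oplus>\<^bsub>poly_ring L\<^esub> poly_of_const (\<ominus> a) = Y"
        using a by (auto simp: Y_def univ_poly_add var_def poly_of_const_def)
      then show ?thesis using a by (simp add: A_def a_minus_def)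
    qed
    have "A [^]\<^bsub>poly_ring L\<^esub> q = A" using const.hom_nat_pow[OF a(1), of q] a(2) by (simp add: A_def)
    then have "Y [^]\<^bsub>poly_ring L\<^esub> q = X [^]\<^bsub>poly_ring L\<^esub> q \<ominus>\<^bsub>poly_ring L\<^esub> A"
      using UP.freshmans_dream[OF p pol_char X UP.a_inv_closed[OF A], of m]
        UP.freshmans_dream_minus[OF p pol_char A, of m]
      unfolding XYA q_def a_minus_def by simp
    then have PY: "P = Y [^]\<^bsub>poly_ring L\<^esub> q \<ominus>\<^bsub>poly_ring L\<^esub> Y"
      unfolding P_def using X A XYA UP.nat_pow_closed[OF X, of q] by (simp, algebra)
    have "(Y [^]\<^bsub>poly_ring L\<^esub> (2::nat)) pdivides P"
      using le_alg_mult_imp_pdivides[OF a(1) P, of 2] \<open>\<not> alg_mult P a \<le> 1\<close> by (simp add: Y_def)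
    then obtain h where h: "h \<in> carrier (poly_ring L)"
        "P = Y [^]\<^bsub>poly_ring L\<^esub> (2::nat) \<otimes>\<^bsub>poly_ring L\<^esub> h"
      unfolding pdivides_def factor_def by blast
    obtain r where r: "q = Suc (Suc r)" using q2 by (metis add_2_eq_Suc le_Suc_ex)
    define W where "W = Y [^]\<^bsub>poly_ring L\<^esub> r"
    have W: "W \<in> carrier (poly_ring L)" using Y by (simp add: W_def)
    have Yq: "Y [^]\<^bsub>poly_ring L\<^esub> q = W \<otimes>\<^bsub>poly_ring L\<^esub> Y \<otimes>\<^bsub>poly_ring L\<^esub> Y"
      by (simp add: r W_def)
    have Y2: "Y [^]\<^bsub>poly_ring L\<^esub> (2::nat) = Y \<otimes>\<^bsub>poly_ring L\<^esub> Y"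
      using Y by (simp add: numeral_2_eq_2)
    have "Y \<otimes>\<^bsub>poly_ring L\<^esub> (Y \<otimes>\<^bsub>poly_ring L\<^esub> (W \<ominus>\<^bsub>poly_ring L\<^esub> h)) =
        Y \<otimes>\<^bsub>poly_ring L\<^esub> \<one>\<^bsub>poly_ring L\<^esub>"
    proof -
      have "Y \<otimes>\<^bsub>poly_ring L\<^esub> (Y \<otimes>\<^bsub>poly_ring L\<^esub> (W \<ominus>\<^bsub>poly_ring L\<^esub> h)) =
          W \<otimes>\<^bsub>poly_ring L\<^esub> Y \<otimes>\<^bsub>poly_ring L\<^esub> Y \<ominus>\<^bsub>poly_ring L\<^esub>
          Y \<otimes>\<^bsub>poly_ring L\<^esub> Y \<otimes>\<^bsub>poly_ring L\<^esub> h"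
        using Y W h(1) by algebra
      also have "\<dots> = W \<otimes>\<^bsub>poly_ring L\<^esub> Y \<otimes>\<^bsub>poly_ring L\<^esub> Y \<ominus>\<^bsub>poly_ring L\<^esub>
          (W \<otimes>\<^bsub>poly_ring L\<^esub> Y \<otimes>\<^bsub>poly_ring L\<^esub> Y \<ominus>\<^bsub>poly_ring L\<^esub> Y)"
        using h(2) PY Yq Y2 by simp
      also have "\<dots> = Y \<otimes>\<^bsub>poly_ring L\<^esub> \<one>\<^bsub>poly_ring L\<^esub>" using Y W by algebra
      finally show ?thesis .
    qed
    moreover have "Y \<noteq> \<zero>\<^bsub>poly_ring L\<^esub>" by (simp add: Y_def univ_poly_zero)
    ultimately have "Y \<otimes>\<^bsub>poly_ring L\<^esub> (W \<ominus>\<^bsub>poly_ring L\<^esub> h) = \<one>\<^bsub>poly_ring L\<^esub>"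
      using Y W h(1) by (subst (asm) UP.m_lcancel) auto
    then have "Y \<in> Units (poly_ring L)"
      using Y W h(1) UP.m_comm by (auto simp: Units_def intro!: bexI[of _ "W \<ominus>\<^bsub>poly_ring L\<^esub> h"])
    then show False using univ_poly_units_incl[OF carrier_is_subring] by (auto simp: Y_def)
  qed
  have cnt: "count (roots P) a = 1" if "a \<in># roots P" for a
    using that simple[of a] roots_mem_iff_is_root[OF P, of a] root[of a] alg_mult_eq_count_roots[OF P]
    by (metis One_nat_def Suc_leI count_greater_zero_iff le_antisym)
  have "size (roots P) = q" using roots_over_carrier[OF P] \<open>degree P = q\<close> by (simp add: splitted_def)
  moreover have "size (roots P) = card (set_mset (roots P))"
    using cnt by (simp add: size_multiset_overloaded_eq)
  moreover have "set_mset (roots P) = {a \<in> carrier L. a [^] q = a}"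
    using roots_mem_iff_is_root[OF P] root by auto
  ultimately show ?thesis by (simp add: q_def)
qed


text \<open>The Frobenius-fixed elements of the algebraic closure of the prime field form the field
  sought. It is renumbered to \<open>{..<q}\<close> so that the fields for all \<open>q\<close>
  share one type.\<close>

lemma exists_field_of_primepow_card:
  assumes "primepow (q :: nat)"
  shows "\<exists>K :: nat ring. field K \<and> carrier K = {..<q}"
proof -
  obtain p m where p: "prime p" and m: "0 < m" and q: "q = p ^ m"
    using assms by (auto simp: primepow_def)
  define Z where "Z = residue_ring (int p)"
  interpret Z: residues_prime p Z by unfold_locales (auto simp: p Z_def)
  define L where "L = field.alg_closure Z"
  interpret L: algebraic_closure L "Z.indexed_const ` carrier Z"
    unfolding L_def by (rule Z.alg_closureE)
  interpret h: ring_hom_ring Z L Z.indexed_const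
    using Z.alg_closureE(2) unfolding L_def[symmetric]
    by (intro ring_hom_ringI2) (auto intro: Z.ring_axioms L.ring_axioms)
  have char: "[p] \<cdot>\<^bsub>L\<^esub> \<one>\<^bsub>L\<^esub> = \<zero>\<^bsub>L\<^esub>"
  proof -
    have "[n] \<cdot>\<^bsub>Z\<^esub> \<one>\<^bsub>Z\<^esub> = int n mod int p" for n
      by (induction n) (auto simp: Z.zero_cong Z.one_cong Z.add_cong Z.res_zero_eq Z.res_one_eq Z.res_add_eq mod_simps add.commute)
    then have "[p] \<cdot>\<^bsub>Z\<^esub> \<one>\<^bsub>Z\<^esub> = \<zero>\<^bsub>Z\<^esub>" by (simp add: Z.res_zero_eq)
    moreover have "Z.indexed_const ([n] \<cdot>\<^bsub>Z\<^esub> \<one>\<^bsub>Z\<^esub>) = [n] \<cdot>\<^bsub>L\<^esub> \<one>\<^bsub>L\<^esub>" for n :: nat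
      by (induction n) auto
    ultimately show ?thesis by (metis h.hom_zero)
  qed
  define U where "U = {a \<in> carrier L. a [^]\<^bsub>L\<^esub> q = a}"
  have "card U = q" using L.card_frobenius_fixed[OF p m char] by (simp add: U_def q)
  have q0: "0 < q" using p by (simp add: q prime_gt_0_nat)
  then have finU: "finite U" using \<open>card U = q\<close> card_gt_0_iff by metis
  have "subfield U L"
  proof (rule L.subfieldI')
    show "subring U L"
    proof (rule L.subringI)
      show "\<ominus>\<^bsub>L\<^esub> x \<in> U" if "x \<in> U" for x
        using that L.freshmans_dream_minus[OF p char, of x m] by (simp add: U_def q)
      show "x \<otimes>\<^bsub>L\<^esub> y \<in> U" if "x \<in> U" "y \<in> U" for x y
        using that by (simp add: U_def L.nat_pow_distrib)
      show "x \<oplus>\<^bsub>L\<^esub> y \<in> U" if "x \<in> U" "y \<in> U" for x y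
        using that L.freshmans_dream[OF p char, of x y m] by (simp add: U_def q)
    qed (auto simp: U_def)
    show "inv\<^bsub>L\<^esub> k \<in> U" if k: "k \<in> U - {\<zero>\<^bsub>L\<^esub>}" for k
    proof -
      have u: "k \<in> Units L" "k [^]\<^bsub>L\<^esub> q = k" using k by (auto simp: U_def L.field_Units)
      have "(inv\<^bsub>L\<^esub> k) [^]\<^bsub>L\<^esub> q = inv\<^bsub>L\<^esub> (k [^]\<^bsub>L\<^esub> q)"
        using u(1) by (metis L.Units_closed L.Units_inv_closed L.Units_l_inv L.inv_char L.m_comm L.nat_pow_closed L.nat_pow_distrib L.nat_pow_one)
      then show ?thesis using u by (simp add: U_def)
    qed
  qed
  then interpret U: field "L\<lparr>carrier := U\<rparr>" by (rule L.subfield_iff(2))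
  obtain f where f: "bij_betw f U {..<q}"
    using ex_bij_betw_finite_nat[OF finU] \<open>card U = q\<close> by (auto simp: atLeast0LessThan)
  define g where "g = inv_into U f"
  have gf: "g (f a) = a" if "a \<in> U" for a
    using that f by (simp add: g_def bij_betw_def)
  define K where "K = \<lparr>carrier = {..<q}, monoid.mult = (\<lambda>a b. f (g a \<otimes>\<^bsub>L\<^esub> g b)),
    one = f \<one>\<^bsub>L\<^esub>, zero = f \<zero>\<^bsub>L\<^esub>, add = (\<lambda>a b. f (g a \<oplus>\<^bsub>L\<^esub> g b))\<rparr>"
  have "f \<in> ring_iso (L\<lparr>carrier := U\<rparr>) K"
    using f by (intro ring_iso_memI) (auto simp: K_def gf bij_betw_def)
  then have "field (K\<lparr>zero := f \<zero>\<^bsub>L\<^esub>\<rparr>)" using U.ring_iso_imp_img_field by simp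
  then have "field K" by (simp add: K_def)
  then show ?thesis by (intro exI[of _ K]) (simp add: K_def)
qed

text \<open>A finite field inside a commutative ring, with its own unit \<open>e\<close>. Polynomial
  identities can be checked by simplification in the surrounding ring; only closure, division and
  cancellation refer to \<open>F\<close>.\<close>

locale corner_field =
  fixes F :: "'r :: comm_ring_1 set" and e :: 'r
  assumes finite_F: "finite F"
    and zero_F [simp]: "0 \<in> F" and e_F [simp]: "e \<in> F" and e_nz [simp]: "e \<noteq> 0"
    and e_mult [simp]: "x \<in> F \<Longrightarrow> e * x = x"
    and add_F [simp]: "x \<in> F \<Longrightarrow> y \<in> F \<Longrightarrow> x + y \<in> F"
    and mult_F [simp]: "x \<in> F \<Longrightarrow> y \<in> F \<Longrightarrow> x * y \<in> F"
    and uminus_F [simp]: "x \<in> F \<Longrightarrow> - x \<in> F"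
    and inverse_F: "x \<in> F \<Longrightarrow> x \<noteq> 0 \<Longrightarrow> \<exists>y\<in>F. x * y = e"

text \<open>The default 2 makes every component a field, so the product over all \<open>q\<close> is
  a commutative ring with 0 and 1 distinct.\<close>

definition GF :: "nat \<Rightarrow> nat ring" where
  "GF q = (SOME K. field K \<and> carrier K = {..<if primepow q then q else 2})"

lemma GF: "field (GF q)" "carrier (GF q) = {..<if primepow q then q else 2}"
proof -
  have "primepow (if primepow q then q else 2)" by (simp add: primepow_prime)
  from exists_field_of_primepow_card[OF this]
  have "field (GF q) \<and> carrier (GF q) = {..<if primepow q then q else 2}"
    unfolding GF_def by (rule someI_ex)
  then show "field (GF q)" "carrier (GF q) = {..<if primepow q then q else 2}" by auto
qed

text \<open>There is no type of cardinality \<open>q\<close> for a variable \<open>q\<close>.  The product of all finite fields is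
  a single type, and \<open>GF q\<close> sits in it as the ideal of elements supported at \<open>q\<close>; that ideal has its
  own unit, different from \<open>1\<close>.\<close>

typedef galois_product = "{f :: nat \<Rightarrow> nat. \<forall>q. f q \<in> carrier (GF q)}"
  morphisms component Abs_galois_product
proof
  show "(\<lambda>q. \<zero>\<^bsub>GF q\<^esub>) \<in> {f. \<forall>q. f q \<in> carrier (GF q)}"
    using GF(1) by (auto intro: ring.ring_simprules(2) field.is_ring)
qed

setup_lifting type_definition_galois_product

lemma GF_ring: "ring (GF q)" and GF_cring: "cring (GF q)" and GF_domain: "domain (GF q)"
  using GF(1) by (auto intro: field.is_ring fieldE(1) field.axioms(1))

instantiation galois_product :: comm_ring_1
begin

lift_definition zero_galois_product :: galois_product is "\<lambda>q. \<zero>\<^bsub>GF q\<^esub>"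
  by (rule ring.ring_simprules(2)[OF GF_ring])

lift_definition one_galois_product :: galois_product is "\<lambda>q. \<one>\<^bsub>GF q\<^esub>"
  by (rule ring.ring_simprules(6)[OF GF_ring])

lift_definition plus_galois_product :: "galois_product \<Rightarrow> galois_product \<Rightarrow> galois_product"
  is "\<lambda>x y q. x q \<oplus>\<^bsub>GF q\<^esub> y q" by (simp add: ring.ring_simprules(1)[OF GF_ring])

lift_definition times_galois_product :: "galois_product \<Rightarrow> galois_product \<Rightarrow> galois_product"
  is "\<lambda>x y q. x q \<otimes>\<^bsub>GF q\<^esub> y q" by (simp add: ring.ring_simprules(5)[OF GF_ring])

lift_definition uminus_galois_product :: "galois_product \<Rightarrow> galois_product"
  is "\<lambda>x q. \<ominus>\<^bsub>GF q\<^esub> x q" by (simp add: ring.ring_simprules(3)[OF GF_ring])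

lift_definition minus_galois_product :: "galois_product \<Rightarrow> galois_product \<Rightarrow> galois_product"
  is "\<lambda>x y q. x q \<ominus>\<^bsub>GF q\<^esub> y q" by (simp add: ring.ring_simprules(4)[OF GF_ring])

instance
proof
  fix a b c :: galois_product
  show "a * b * c = a * (b * c)"
    by transfer (simp add: monoid.m_assoc[OF ring.is_monoid[OF GF_ring]])
  show "a * b = b * a"
    by transfer (simp add: cring.cring_simprules(14)[OF GF_cring])
  show "1 * a = a"
    by transfer (simp add: cring.cring_simprules(12)[OF GF_cring])
  show "a + b + c = a + (b + c)"
    by transfer (simp add: cring.cring_simprules(7)[OF GF_cring])
  show "a + b = b + a"
    by transfer (simp add: cring.cring_simprules(10)[OF GF_cring])
  show "0 + a = a"
    by transfer (simp add: cring.cring_simprules(8)[OF GF_cring])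
  show "- a + a = 0"
    by transfer (simp add: cring.cring_simprules(9)[OF GF_cring])
  show "a - b = a + - b"
    by transfer (simp add: a_minus_def)
  show "(a + b) * c = a * c + b * c"
    by transfer (simp add: cring.cring_simprules(13)[OF GF_cring])
  show "(0 :: galois_product) \<noteq> 1"
    by transfer (auto simp: fun_eq_iff domain.one_not_zero[OF GF_domain, symmetric])
qed

end

lemma exists_corner_field:
  assumes q: "primepow q"
  shows "\<exists>F (e :: galois_product). corner_field F e \<and> card F = q"
proof -
  interpret field "GF q" by (rule GF(1))
  have carr: "carrier (GF q) = {..<q}" using GF(2)[of q] q by simp
  define \<iota> where "\<iota> a = Abs_galois_product (\<lambda>r. if r = q then a else \<zero>\<^bsub>GF r\<^esub>)" for a
  have comp: "component (\<iota> a) = (\<lambda>r. if r = q then a else \<zero>\<^bsub>GF r\<^esub>)" if "a \<in> carrier (GF q)" for a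
    unfolding \<iota>_def using that
    by (subst Abs_galois_product_inverse) (auto intro: ring.ring_simprules(2)[OF GF_ring])
  have zz: "\<zero>\<^bsub>GF r\<^esub> \<oplus>\<^bsub>GF r\<^esub> \<zero>\<^bsub>GF r\<^esub> = \<zero>\<^bsub>GF r\<^esub>" "\<zero>\<^bsub>GF r\<^esub> \<otimes>\<^bsub>GF r\<^esub> \<zero>\<^bsub>GF r\<^esub> = \<zero>\<^bsub>GF r\<^esub>"
    "\<ominus>\<^bsub>GF r\<^esub> \<zero>\<^bsub>GF r\<^esub> = \<zero>\<^bsub>GF r\<^esub>" for r
  proof -
    interpret r: ring "GF r" by (rule GF_ring)
    show "\<zero>\<^bsub>GF r\<^esub> \<oplus>\<^bsub>GF r\<^esub> \<zero>\<^bsub>GF r\<^esub> = \<zero>\<^bsub>GF r\<^esub>" "\<zero>\<^bsub>GF r\<^esub> \<otimes>\<^bsub>GF r\<^esub> \<zero>\<^bsub>GF r\<^esub> = \<zero>\<^bsub>GF r\<^esub>"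
      "\<ominus>\<^bsub>GF r\<^esub> \<zero>\<^bsub>GF r\<^esub> = \<zero>\<^bsub>GF r\<^esub>" by auto
  qed
  have add: "\<iota> a + \<iota> b = \<iota> (a \<oplus>\<^bsub>GF q\<^esub> b)"
    and mult: "\<iota> a * \<iota> b = \<iota> (a \<otimes>\<^bsub>GF q\<^esub> b)"
    and neg: "- \<iota> a = \<iota> (\<ominus>\<^bsub>GF q\<^esub> a)"
    if "a \<in> carrier (GF q)" "b \<in> carrier (GF q)" for a b
    using that by (auto simp: component_inject[symmetric] comp plus_galois_product.rep_eq
        times_galois_product.rep_eq uminus_galois_product.rep_eq fun_eq_iff zz)
  have zero: "\<iota> \<zero>\<^bsub>GF q\<^esub> = 0"
    by (auto simp: component_inject[symmetric] comp zero_galois_product.rep_eq fun_eq_iff)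
  have inj: "inj_on \<iota> (carrier (GF q))"
    by (rule inj_onI) (metis comp)
  have "corner_field (\<iota> ` carrier (GF q)) (\<iota> \<one>\<^bsub>GF q\<^esub>)"
  proof
    show "0 \<in> \<iota> ` carrier (GF q)" using zero by (metis image_eqI zero_closed)
    show "\<iota> \<one>\<^bsub>GF q\<^esub> \<noteq> 0" using zero inj by (metis inj_onD one_closed one_not_zero zero_closed)
    show "\<exists>y\<in>\<iota> ` carrier (GF q). x * y = \<iota> \<one>\<^bsub>GF q\<^esub>"
      if x: "x \<in> \<iota> ` carrier (GF q)" "x \<noteq> 0" for x
    proof -
      obtain a where a: "x = \<iota> a" "a \<in> carrier (GF q)" using x by blast
      then have "a \<in> Units (GF q)" using x(2) zero by (auto simp: field_Units)
      then have "\<iota> a * \<iota> (inv\<^bsub>GF q\<^esub> a) = \<iota> \<one>\<^bsub>GF q\<^esub>" "inv\<^bsub>GF q\<^esub> a \<in> carrier (GF q)"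
        using a by (auto simp: mult)
      then show ?thesis using a by blast
    qed
    show "finite (\<iota> ` carrier (GF q))" using carr by simp
  qed (auto simp: add mult neg)
  moreover have "card (\<iota> ` carrier (GF q)) = q" using inj carr by (simp add: card_image)
  ultimately show ?thesis by blast
qed

section \<open>Polygons from groups of linear maps\<close>

context corner_field
begin

lemma minus_F [simp]: "x \<in> F \<Longrightarrow> y \<in> F \<Longrightarrow> x - y \<in> F"
  using add_F[of x "- y"] by simp

lemma double_F [simp]: "x \<in> F \<Longrightarrow> 2 * x \<in> F"
  using add_F[of x x] by (simp only: mult_2)

lemma mult_e [simp]: "x \<in> F \<Longrightarrow> x * e = x"
  using e_mult[of x] by (simp add: mult.commute)

text \<open>The surrounding ring may have zero divisors, and a product of fields does; cancellation
  is valid inside \<open>F\<close> because nonzero elements are invertible there.\<close>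

lemma mult_eq_0_F:
  assumes "x \<in> F" "y \<in> F" "x * y = 0"
  shows "x = 0 \<or> y = 0"
proof (rule disjCI)
  assume "y \<noteq> 0"
  then obtain z where "z \<in> F" "y * z = e" using inverse_F[OF assms(2)] by blast
  then show "x = 0" using assms by (metis mult.assoc mult_e mult_zero_left)
qed

end

section \<open>Leading positions and the orbit of the root flag\<close>

definition comb :: "'r :: comm_ring_1 \<Rightarrow> (nat \<Rightarrow> 'r) \<Rightarrow> 'r \<Rightarrow> (nat \<Rightarrow> 'r) \<Rightarrow> nat \<Rightarrow> 'r" where
  "comb a x b y = (\<lambda>i. a * x i + b * y i)"

definition is_lead :: "(nat \<Rightarrow> 'r :: zero) \<Rightarrow> nat \<Rightarrow> bool" where
  "is_lead x i \<longleftrightarrow> x i \<noteq> 0 \<and> (\<forall>j>i. x j = 0)"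

text \<open>For a subspace this is the set of pivot positions of an echelon basis, that is, the
  label of its Schubert cell.\<close>

definition leads :: "(nat \<Rightarrow> 'r :: zero) set \<Rightarrow> nat set" where
  "leads S = {i. \<exists>x\<in>S. is_lead x i}"

lemma is_lead_unique: "is_lead x i \<Longrightarrow> is_lead x j \<Longrightarrow> i = j"
  unfolding is_lead_def by (metis linorder_neqE_nat)

locale vector_geometry = corner_field F e
  for F :: "'r :: comm_ring_1 set" and e :: 'r +
  fixes N :: nat and Z :: "(nat \<Rightarrow> 'r) \<Rightarrow> (nat \<Rightarrow> 'r) \<Rightarrow> bool"
  assumes N: "3 \<le> N"
begin

definition V :: "(nat \<Rightarrow> 'r) set" where
  "V = {x. (\<forall>i. x i \<in> F) \<and> (\<forall>i\<ge>N. x i = 0)}"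

definition bv :: "nat \<Rightarrow> nat \<Rightarrow> 'r" where
  "bv i = (\<lambda>j. if j = i then e else 0)"

definition span1 :: "(nat \<Rightarrow> 'r) \<Rightarrow> (nat \<Rightarrow> 'r) set" where
  "span1 x = {comb a x 0 x | a. a \<in> F}"

definition span2 :: "(nat \<Rightarrow> 'r) \<Rightarrow> (nat \<Rightarrow> 'r) \<Rightarrow> (nat \<Rightarrow> 'r) set" where
  "span2 x y = {comb a x b y | a b. a \<in> F \<and> b \<in> F}"

definition morph :: "((nat \<Rightarrow> 'r) \<Rightarrow> (nat \<Rightarrow> 'r)) \<Rightarrow> bool" where
  "morph g \<longleftrightarrow> g \<in> V \<rightarrow> V \<and>
     (\<forall>x\<in>V. \<forall>y\<in>V. \<forall>a\<in>F. \<forall>b\<in>F. g (comb a x b y) = comb a (g x) b (g y)) \<and>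
     (\<forall>x\<in>V. \<forall>y\<in>V. Z x y \<longrightarrow> Z (g x) (g y))"

definition auts :: "((nat \<Rightarrow> 'r) \<Rightarrow> (nat \<Rightarrow> 'r)) set" where
  "auts = {g. morph g \<and> (\<exists>h. morph h \<and> (\<forall>x\<in>V. h (g x) = x \<and> g (h x) = x))}"

definition P0 :: "(nat \<Rightarrow> 'r) set" where "P0 = span1 (bv 0)"

definition L0 :: "(nat \<Rightarrow> 'r) set" where "L0 = span2 (bv 0) (bv 1)"

definition flags :: "((nat \<Rightarrow> 'r) set \<times> (nat \<Rightarrow> 'r) set) set" where
  "flags = {(g ` P0, g ` L0) | g. g \<in> auts}"

lemma V_F: "x \<in> V \<Longrightarrow> x i \<in> F" and V_0: "x \<in> V \<Longrightarrow> N \<le> i \<Longrightarrow> x i = 0"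
  by (auto simp: V_def)

lemma comb_V [simp]: "a \<in> F \<Longrightarrow> b \<in> F \<Longrightarrow> x \<in> V \<Longrightarrow> y \<in> V \<Longrightarrow> comb a x b y \<in> V"
  by (auto simp: V_def comb_def)

lemma bv_V: "i < N \<Longrightarrow> bv i \<in> V"
  by (auto simp: V_def bv_def)

lemma bv012 [simp]: "bv 0 \<in> V" "bv 1 \<in> V" "bv (Suc 0) \<in> V" "bv 2 \<in> V"
  using N by (auto intro!: bv_V)

lemma finite_V: "finite V"
proof (rule finite_subset)
  show "V \<subseteq> {f. \<forall>i. (i \<in> {..<N} \<longrightarrow> f i \<in> F) \<and> (i \<notin> {..<N} \<longrightarrow> f i = 0)}"
    by (auto simp: V_def)
  show "finite {f. \<forall>i. (i \<in> {..<N} \<longrightarrow> f i \<in> F) \<and> (i \<notin> {..<N} \<longrightarrow> f i = 0)}"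
    by (rule finite_set_of_finite_funs[OF _ finite_F]) simp
qed

lemma comb_comb:
  "comb a (comb s x t y) b (comb s' x t' y) = comb (a * s + b * s') x (a * t + b * t') y"
  by (auto simp: comb_def algebra_simps)

lemma comb_e0 [simp]: "x \<in> V \<Longrightarrow> comb e x 0 y = x" and comb_0e [simp]: "y \<in> V \<Longrightarrow> comb 0 x e y = y"
  by (auto simp: comb_def V_def)

lemma span1_V: "x \<in> V \<Longrightarrow> span1 x \<subseteq> V"
  by (auto simp: span1_def)

lemma span2_V: "x \<in> V \<Longrightarrow> y \<in> V \<Longrightarrow> span2 x y \<subseteq> V"
  by (auto simp: span2_def)

lemma span1I: "a \<in> F \<Longrightarrow> comb a x 0 x \<in> span1 x"
  by (auto simp: span1_def)

lemma span2I: "a \<in> F \<Longrightarrow> b \<in> F \<Longrightarrow> comb a x b y \<in> span2 x y"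
  by (auto simp: span2_def)

lemma in_span1: "x \<in> V \<Longrightarrow> x \<in> span1 x"
  using span1I[of e x] by simp

lemma in_span2: "x \<in> V \<Longrightarrow> x \<in> span2 x y" "y \<in> V \<Longrightarrow> y \<in> span2 x y"
  using span2I[of e 0 x y] span2I[of 0 e x y] by simp_all

lemma comb_in_span2:
  assumes "u \<in> span2 x y" "w \<in> span2 x y" "a \<in> F" "b \<in> F"
  shows "comb a u b w \<in> span2 x y"
proof -
  obtain s t s' t' where "u = comb s x t y" "w = comb s' x t' y" "s \<in> F" "t \<in> F" "s' \<in> F" "t' \<in> F"
    using assms(1,2) by (auto simp: span2_def)
  then have "comb a u b w = comb (a * s + b * s') x (a * t + b * t') y"
      "a * s + b * s' \<in> F" "a * t + b * t' \<in> F"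
    using assms(3,4) by (auto simp: comb_comb)
  then show ?thesis by (simp add: span2I)
qed

lemma span2_subset: "u \<in> span2 x y \<Longrightarrow> w \<in> span2 x y \<Longrightarrow> span2 u w \<subseteq> span2 x y"
  using comb_in_span2 by (auto simp: span2_def[of u w])

lemma span1_subset_span2: "u \<in> span2 x y \<Longrightarrow> span1 u \<subseteq> span2 x y"
  using comb_in_span2[of u x y u] by (auto simp: span1_def)

lemma span1_eq:
  assumes "x \<in> V" "y \<in> span1 x" "y \<noteq> (\<lambda>_. 0)"
  shows "span1 y = span1 x"
proof -
  obtain a where a: "a \<in> F" "y = comb a x 0 x" using assms(2) by (auto simp: span1_def)
  have "a \<noteq> 0" using assms(3) a by (auto simp: comb_def)
  then obtain b where b: "b \<in> F" "a * b = e" using a inverse_F by blast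
  have x: "x i = b * (a * x i)" for i
    using V_F[OF assms(1), of i] b by (metis e_mult mult.assoc mult.commute)
  have "comb s y 0 y \<in> span1 x" if "s \<in> F" for s
    using that a span1I[of "s * a" x] by (simp add: comb_def mult.assoc)
  moreover have "comb s x 0 x \<in> span1 y" if "s \<in> F" for s
  proof -
    have "comb s x 0 x = comb (s * b) y 0 y" using x a by (simp add: comb_def mult.assoc)
    then show ?thesis using span1I[of "s * b" y] that b by simp
  qed
  ultimately show ?thesis by (auto simp: span1_def[of x] span1_def[of y])
qed

lemma morph_comp: "morph g \<Longrightarrow> morph h \<Longrightarrow> morph (g \<circ> h)"
  by (auto simp: morph_def Pi_iff)

lemma autsI:
  assumes "morph g" "morph h" "\<And>x. x \<in> V \<Longrightarrow> h (g x) = x" "\<And>x. x \<in> V \<Longrightarrow> g (h x) = x"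
  shows "g \<in> auts"
  unfolding auts_def mem_Collect_eq using assms by (intro conjI exI[of _ h]) auto

lemma autsD: "g \<in> auts \<Longrightarrow> \<exists>h. morph g \<and> morph h \<and> (\<forall>x\<in>V. h (g x) = x \<and> g (h x) = x)"
  by (simp add: auts_def)

lemma morph_V: "morph g \<Longrightarrow> x \<in> V \<Longrightarrow> g x \<in> V"
  by (auto simp: morph_def)

lemma aut_comp: assumes "g \<in> auts" "h \<in> auts" shows "g \<circ> h \<in> auts"
proof -
  obtain g' where g: "morph g" "morph g'" "\<forall>x\<in>V. g' (g x) = x \<and> g (g' x) = x"
    using autsD[OF assms(1)] by blast
  obtain h' where h: "morph h" "morph h'" "\<forall>x\<in>V. h' (h x) = x \<and> h (h' x) = x"
    using autsD[OF assms(2)] by blast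
  show ?thesis
    using morph_comp[OF g(1) h(1)] morph_comp[OF h(2) g(2)]
    by (rule autsI) (simp_all add: g h morph_V)
qed

lemma aut_id: "id \<in> auts"
proof -
  have "morph id" by (simp add: morph_def)
  then show ?thesis using autsI[of id id] by simp
qed

lemma aut_inverse:
  assumes "g \<in> auts"
  obtains h where "h \<in> auts" "\<forall>x\<in>V. h (g x) = x" "\<forall>x\<in>V. g (h x) = x"
proof -
  obtain h where h: "morph g" "morph h" "\<forall>x\<in>V. h (g x) = x \<and> g (h x) = x"
    using autsD[OF assms] by blast
  then have "h \<in> auts" by (intro autsI[of h g]) auto
  then show ?thesis using that h(3) by auto
qed

lemma aut_V: "g \<in> auts \<Longrightarrow> x \<in> V \<Longrightarrow> g x \<in> V"
  using autsD morph_V by blast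

lemma aut_comb: "g \<in> auts \<Longrightarrow> x \<in> V \<Longrightarrow> y \<in> V \<Longrightarrow> a \<in> F \<Longrightarrow> b \<in> F \<Longrightarrow>
    g (comb a x b y) = comb a (g x) b (g y)"
  by (auto simp: auts_def morph_def)

lemma aut_Z: "g \<in> auts \<Longrightarrow> x \<in> V \<Longrightarrow> y \<in> V \<Longrightarrow> Z x y \<Longrightarrow> Z (g x) (g y)"
  by (auto simp: auts_def morph_def)

lemma aut_inj:
  assumes "g \<in> auts"
  shows "inj_on g V"
proof -
  obtain h where "\<forall>x\<in>V. h (g x) = x" using autsD[OF assms] by blast
  then show ?thesis by (intro inj_on_inverseI[of V h]) auto
qed

lemma image_span1:
  assumes "g \<in> auts" "x \<in> V"
  shows "g ` span1 x = span1 (g x)"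
proof (intro subset_antisym subsetI)
  fix z assume "z \<in> g ` span1 x"
  then obtain a where "a \<in> F" "z = g (comb a x 0 x)" by (auto simp: span1_def)
  then show "z \<in> span1 (g x)" using assms by (simp add: aut_comb span1I)
next
  fix z assume "z \<in> span1 (g x)"
  then obtain a where "a \<in> F" "z = g (comb a x 0 x)"
    using assms by (auto simp: span1_def aut_comb)
  then show "z \<in> g ` span1 x" by (auto intro: span1I)
qed

lemma image_span2:
  assumes "g \<in> auts" "x \<in> V" "y \<in> V"
  shows "g ` span2 x y = span2 (g x) (g y)"
proof (intro subset_antisym subsetI)
  fix z assume "z \<in> g ` span2 x y"
  then obtain a b where "a \<in> F" "b \<in> F" "z = g (comb a x b y)" by (auto simp: span2_def)
  then show "z \<in> span2 (g x) (g y)" using assms by (simp add: aut_comb span2I)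
next
  fix z assume "z \<in> span2 (g x) (g y)"
  then obtain a b where "a \<in> F" "b \<in> F" "z = g (comb a x b y)"
    using assms by (auto simp: span2_def aut_comb)
  then show "z \<in> g ` span2 x y" by (auto intro: span2I)
qed

lemma P0_V: "P0 \<subseteq> V" and L0_V: "L0 \<subseteq> V" and P0_L0: "P0 \<subseteq> L0"
  unfolding P0_def L0_def
  by (simp_all add: span1_V span2_V span1_subset_span2 in_span2 del: One_nat_def)

lemma aut_nonzero:
  assumes "g \<in> auts" "x \<in> V" "x \<noteq> (\<lambda>_. 0)"
  shows "g x \<noteq> (\<lambda>_. 0)"
proof -
  have "g (\<lambda>_. 0) = (\<lambda>_. 0)" using aut_comb[OF assms(1,2,2), of 0 0] by (simp add: comb_def)
  moreover have "(\<lambda>_. 0) \<in> V" by (simp add: V_def)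
  ultimately show ?thesis using aut_inj[OF assms(1)] assms(2,3) by (metis inj_onD)
qed

lemma exists_lead: "x \<in> V \<Longrightarrow> x \<noteq> (\<lambda>_. 0) \<Longrightarrow> \<exists>i<N. is_lead x i"
proof -
  assume x: "x \<in> V" "x \<noteq> (\<lambda>_. 0)"
  define S where "S = {i. x i \<noteq> 0}"
  have S: "S \<subseteq> {..<N}" using x V_0[OF x(1)] by (auto simp: S_def not_le[symmetric])
  then have fin: "finite S" by (rule finite_subset) simp
  have "S \<noteq> {}" using x by (auto simp: S_def)
  then have "is_lead x (Max S)" using fin Max_in[of S] Max_ge[of S]
    by (auto simp: is_lead_def S_def)
  then show ?thesis using S Max_in[OF fin \<open>S \<noteq> {}\<close>] by auto
qed

lemma leads_span1:
  assumes "x \<in> V" "is_lead x i"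
  shows "leads (span1 x) = {i}"
proof -
  have "is_lead x j" if j: "is_lead (comb a x 0 x) j" "a \<in> F" for a j
  proof -
    have "a * x k = 0 \<longleftrightarrow> a = 0 \<or> x k = 0" for k
      using mult_eq_0_F[OF j(2) V_F[OF assms(1)]] by auto
    then show ?thesis using j(1) by (auto simp: is_lead_def comb_def)
  qed
  then have "leads (span1 x) \<subseteq> {i}"
    using assms(2) is_lead_unique by (fastforce simp: leads_def span1_def)
  then show ?thesis using assms in_span1 by (auto simp: leads_def)
qed

text \<open>As \<open>i \<noteq> j\<close>, a nonzero combination leads at the larger of the
  positions whose coefficients do not vanish; nothing can cancel there.\<close>

lemma leads_span2:
  assumes V: "x \<in> V" "y \<in> V" and lead: "is_lead x i" "is_lead y j" "i \<noteq> j"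
  shows "leads (span2 x y) = {i, j}"
proof -
  have nz: "a * x k = 0 \<longleftrightarrow> a = 0 \<or> x k = 0" "a * y k = 0 \<longleftrightarrow> a = 0 \<or> y k = 0" if "a \<in> F" for a k
    using mult_eq_0_F[OF that V_F[OF V(1)]] mult_eq_0_F[OF that V_F[OF V(2)]] by auto
  have "l \<in> {i, j}" if l: "is_lead (comb a x b y) l" and ab: "a \<in> F" "b \<in> F" for a b l
  proof -
    have "is_lead (comb a x b y) i" if "a \<noteq> 0" "b = 0 \<or> j < i"
      using that lead ab by (auto simp: is_lead_def comb_def nz)
    moreover have "is_lead (comb a x b y) j" if "b \<noteq> 0" "a = 0 \<or> i < j"
      using that lead ab by (auto simp: is_lead_def comb_def nz)
    moreover have "a \<noteq> 0 \<or> b \<noteq> 0" using l by (auto simp: is_lead_def comb_def)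
    ultimately show ?thesis using l lead(3) is_lead_unique by (metis insertCI linorder_neqE_nat)
  qed
  then have "leads (span2 x y) \<subseteq> {i, j}" by (auto simp: leads_def span2_def)
  then show ?thesis using assms in_span2 by (auto simp: leads_def)
qed

lemma flag_V:
  assumes "(P, L) \<in> flags"
  shows "P \<subseteq> V" "L \<subseteq> V"
proof -
  obtain g where g: "g \<in> auts" "P = g ` P0" "L = g ` L0" using assms by (auto simp: flags_def)
  show "P \<subseteq> V" "L \<subseteq> V" using g P0_V L0_V aut_V[OF g(1)] by blast+
qed

lemma root_flag: "(P0, L0) \<in> flags"
  unfolding flags_def mem_Collect_eq using aut_id by (intro exI[of _ id]) simp

lemma flag_image:
  assumes "(P, L) \<in> flags" "g \<in> auts"
  shows "(g ` P, g ` L) \<in> flags"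
proof -
  obtain h where h: "h \<in> auts" "P = h ` P0" "L = h ` L0" using assms by (auto simp: flags_def)
  then show ?thesis unfolding flags_def mem_Collect_eq
    using aut_comp[OF assms(2) h(1)] by (intro exI[of _ "g \<circ> h"]) (simp add: image_comp)
qed

lemma image_inverse:
  assumes "\<forall>x\<in>V. h (g x) = x" "S \<subseteq> V"
  shows "h ` g ` S = S"
proof -
  have "h ` g ` S = (\<lambda>x. x) ` S" unfolding image_image using assms by (intro image_cong) auto
  then show ?thesis by simp
qed

lemma card_lines_through:
  assumes "(P, L) \<in> flags"
  shows "card (flags `` {P}) = card (flags `` {P0})"
proof -
  obtain g where g: "g \<in> auts" "P = g ` P0" using assms by (auto simp: flags_def)
  obtain h where h: "h \<in> auts" "\<forall>x\<in>V. h (g x) = x" "\<forall>x\<in>V. g (h x) = x"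
    using aut_inverse[OF g(1)] by blast
  have "bij_betw ((`) g) (flags `` {P0}) (flags `` {P})"
  proof (rule bij_betw_byWitness[where f' = "(`) h"])
    show "\<forall>a\<in>flags `` {P0}. h ` g ` a = a"
      by (auto intro!: image_inverse[of h g, OF h(2)] dest: flag_V(2))
    show "\<forall>a\<in>flags `` {P}. g ` h ` a = a"
      by (auto intro!: image_inverse[of g h, OF h(3)] dest: flag_V(2))
    show "(`) g ` flags `` {P0} \<subseteq> flags `` {P}"
    proof (rule image_subsetI)
      fix a assume "a \<in> flags `` {P0}"
      then show "g ` a \<in> flags `` {P}" using flag_image[OF _ g(1)] g(2) by simp
    qed
    show "(`) h ` flags `` {P} \<subseteq> flags `` {P0}"
    proof (rule image_subsetI)
      fix a assume "a \<in> flags `` {P}"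
      then have "(h ` P, h ` a) \<in> flags" using flag_image[OF _ h(1)] by simp
      then show "h ` a \<in> flags `` {P0}" using image_inverse[of h g, OF h(2) P0_V] g(2) by simp
    qed
  qed
  then show ?thesis by (simp add: bij_betw_same_card)
qed

lemma card_points_on:
  assumes "(P, L) \<in> flags"
  shows "card (flags\<inverse> `` {L}) = card (flags\<inverse> `` {L0})"
proof -
  obtain g where g: "g \<in> auts" "L = g ` L0" using assms by (auto simp: flags_def)
  obtain h where h: "h \<in> auts" "\<forall>x\<in>V. h (g x) = x" "\<forall>x\<in>V. g (h x) = x"
    using aut_inverse[OF g(1)] by blast
  have "bij_betw ((`) g) (flags\<inverse> `` {L0}) (flags\<inverse> `` {L})"
  proof (rule bij_betw_byWitness[where f' = "(`) h"])
    show "\<forall>a\<in>flags\<inverse> `` {L0}. h ` g ` a = a"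
      by (auto intro!: image_inverse[of h g, OF h(2)] dest: flag_V(1))
    show "\<forall>a\<in>flags\<inverse> `` {L}. g ` h ` a = a"
      by (auto intro!: image_inverse[of g h, OF h(3)] dest: flag_V(1))
    show "(`) g ` flags\<inverse> `` {L0} \<subseteq> flags\<inverse> `` {L}"
    proof (rule image_subsetI)
      fix a assume "a \<in> flags\<inverse> `` {L0}"
      then show "g ` a \<in> flags\<inverse> `` {L}" using flag_image[OF _ g(1)] g(2) by simp
    qed
    show "(`) h ` flags\<inverse> `` {L} \<subseteq> flags\<inverse> `` {L0}"
    proof (rule image_subsetI)
      fix a assume "a \<in> flags\<inverse> `` {L}"
      then have "(h ` a, h ` L) \<in> flags" using flag_image[OF _ h(1)] by simp
      then show "h ` a \<in> flags\<inverse> `` {L0}" using image_inverse[of h g, OF h(2) L0_V] g(2) by simp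
    qed
  qed
  then show ?thesis by (simp add: bij_betw_same_card)
qed

end

section \<open>Schubert cells of flags\<close>

context vector_geometry
begin

lemma bv_neq_0 [simp]: "bv i \<noteq> (\<lambda>_. 0)"
proof
  assume "bv i = (\<lambda>_. 0)"
  then have "bv i i = 0" by simp
  then show False by (simp add: bv_def)
qed

lemma span2_shear:
  assumes "x \<in> V" "y \<in> V" "s \<in> F"
  shows "span2 x (comb s x e y) = span2 x y"
proof
  show "span2 x (comb s x e y) \<subseteq> span2 x y"
    using assms by (intro span2_subset in_span2 span2I) auto
  have "comb (- s) x e (comb s x e y) = y"
    using assms V_F[OF assms(1)] V_F[OF assms(2)] by (simp add: comb_def fun_eq_iff algebra_simps)
  then have "y \<in> span2 x (comb s x e y)" using span2I[of "- s" e x "comb s x e y"] assms by simp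
  then show "span2 x y \<subseteq> span2 x (comb s x e y)"
    using assms by (intro span2_subset in_span2) auto
qed

text \<open>One step of Gaussian elimination: adding a multiple of the generator \<open>x\<close> of
  the point to the second generator of the line clears its coordinate at the leading position of
  \<open>x\<close>, so the new generator leads elsewhere.\<close>

lemma flag_leads:
  assumes "(P, L) \<in> flags"
  shows "\<exists>i j. i \<noteq> j \<and> leads P = {i} \<and> leads L = {i, j}"
proof -
  obtain g where g: "g \<in> auts" "P = g ` P0" "L = g ` L0" using assms by (auto simp: flags_def)
  define x y where "x = g (bv 0)" and "y = g (bv 1)"
  have V: "x \<in> V" "y \<in> V" using aut_V[OF g(1)] by (auto simp: x_def y_def)
  have P: "P = span1 x" using image_span1[OF g(1), of "bv 0"] by (simp add: g P0_def x_def)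
  have L: "L = span2 x y" using image_span2[OF g(1), of "bv 0" "bv 1"] by (simp add: g L0_def x_def y_def)
  have "x \<noteq> (\<lambda>_. 0)" using aut_nonzero[OF g(1)] by (simp add: x_def)
  then obtain i where i: "is_lead x i" using exists_lead[OF V(1)] by blast
  then obtain b where b: "b \<in> F" "x i * b = e" using inverse_F[OF V_F[OF V(1)], of i] by (auto simp: is_lead_def)
  define s where "s = - (y i * b)"
  have s: "s \<in> F" using b V_F[OF V(2)] by (simp add: s_def)
  define z where "z = comb s x e y"
  have zV: "z \<in> V" using V s by (simp add: z_def)
  have "z = g (comb s (bv 0) e (bv 1))" using aut_comb[OF g(1)] s by (simp add: z_def x_def y_def)
  moreover have "comb s (bv 0) e (bv 1) \<noteq> (\<lambda>_. 0)"
  proof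
    assume "comb s (bv 0) e (bv 1) = (\<lambda>_. 0)"
    then have "comb s (bv 0) e (bv 1) 1 = 0" by simp
    then show False by (simp add: comb_def bv_def)
  qed
  ultimately have "z \<noteq> (\<lambda>_. 0)" using aut_nonzero[OF g(1)] s by simp
  then obtain j where j: "is_lead z j" using exists_lead[OF zV] by blast
  have "s * x i = - (y i * (x i * b))" by (simp add: s_def algebra_simps)
  then have "z i = 0" using b V_F[OF V(2), of i] by (simp add: z_def comb_def)
  then have "i \<noteq> j" using j by (auto simp: is_lead_def)
  moreover have "L = span2 x z" using span2_shear[OF V s] by (simp add: L z_def)
  ultimately show ?thesis
    using leads_span1[OF V(1) i] leads_span2[OF V(1) zV i j] P by blast
qed

text \<open>Together with the next lemma: the lowest cells contain one subspace each, which is why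
  the function \<open>level\<close> below needs an exception at one flag only.\<close>

lemma flag_P0:
  assumes "(P, L) \<in> flags" "leads P = {0}"
  shows "P = P0"
proof -
  obtain g where g: "g \<in> auts" "P = g ` P0" using assms by (auto simp: flags_def)
  define x where "x = g (bv 0)"
  have x: "x \<in> V" "x \<noteq> (\<lambda>_. 0)" using aut_V[OF g(1)] aut_nonzero[OF g(1)] by (auto simp: x_def)
  have P: "P = span1 x" using image_span1[OF g(1), of "bv 0"] by (simp add: g P0_def x_def)
  obtain i where "is_lead x i" using exists_lead[OF x] by blast
  then have "is_lead x 0" using assms(2) leads_span1[OF x(1)] P by auto
  then have "x = comb (x 0) (bv 0) 0 (bv 0)"
    using V_F[OF x(1)] by (auto simp: is_lead_def comb_def bv_def fun_eq_iff)
  then have "x \<in> span1 (bv 0)" using V_F[OF x(1)] span1I by metis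
  then show ?thesis using span1_eq[of "bv 0" x] x by (simp add: P P0_def)
qed

text \<open>The leading positions give an inclusion in \<open>L0\<close>; equality follows by
  cardinality, since \<open>L\<close> is an injective image of \<open>L0\<close>.\<close>

lemma flag_L0:
  assumes "(P, L) \<in> flags" "leads L = {0, 1}"
  shows "L = L0"
proof (rule card_subset_eq)
  show "finite L0" using L0_V finite_V by (rule finite_subset)
  obtain g where g: "g \<in> auts" "L = g ` L0" using assms by (auto simp: flags_def)
  show "card L = card L0" using g(2) inj_on_subset[OF aut_inj[OF g(1)] L0_V] by (simp add: card_image)
  show "L \<subseteq> L0"
  proof
    fix z assume z: "z \<in> L"
    then have zV: "z \<in> V" using flag_V(2)[OF assms(1)] by blast
    have "z k = 0" if k: "2 \<le> k" for k
    proof (cases "z = (\<lambda>_. 0)")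
      case False
      then obtain i where i: "is_lead z i" using exists_lead[OF zV] by blast
      then have "i \<in> {0, 1}" using z assms(2) by (auto simp: leads_def)
      then show ?thesis using i k by (auto simp: is_lead_def)
    qed simp
    then have "z = comb (z 0) (bv 0) (z 1) (bv 1)"
      using V_F[OF zV] by (auto simp: comb_def bv_def fun_eq_iff)
    then show "z \<in> L0" unfolding L0_def using V_F[OF zV] span2I by metis
  qed
qed

text \<open>Counting by cells: \<open>J i\<close> lists coordinates that determine a vector of
  \<open>S\<close> with leading position \<open>i\<close>.\<close>

lemma card_normalised_le:
  assumes "finite I" "\<And>i. i \<in> I \<Longrightarrow> finite (J i)"
    and lead: "\<And>x i. x \<in> S \<Longrightarrow> is_lead x i \<Longrightarrow> i \<in> I"
    and det: "\<And>x y i. x \<in> S \<Longrightarrow> y \<in> S \<Longrightarrow> is_lead x i \<Longrightarrow> is_lead y i \<Longrightarrow>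
      (\<And>j. j \<in> J i \<Longrightarrow> x j = y j) \<Longrightarrow> x = y"
    and S: "S \<subseteq> V" "\<And>x. x \<in> S \<Longrightarrow> \<exists>i. is_lead x i"
  shows "card S \<le> (\<Sum>i\<in>I. card F ^ card (J i))"
proof -
  define T where "T i = {x \<in> S. is_lead x i}" for i
  have finS: "finite S" using S(1) finite_V by (rule finite_subset)
  have "S \<subseteq> (\<Union>i\<in>I. T i)"
  proof
    fix x assume x: "x \<in> S"
    then obtain i where "is_lead x i" using S(2) by blast
    then show "x \<in> (\<Union>i\<in>I. T i)" using x lead by (auto simp: T_def)
  qed
  then have "card S \<le> card (\<Union>i\<in>I. T i)"
    using assms(1) finS by (intro card_mono finite_UN_I) (auto simp: T_def)
  also have "\<dots> \<le> (\<Sum>i\<in>I. card (T i))" by (rule card_UN_le[OF assms(1)])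
  also have "\<dots> \<le> (\<Sum>i\<in>I. card F ^ card (J i))"
  proof (rule sum_mono)
    fix i assume i: "i \<in> I"
    have "card (T i) \<le> card (J i \<rightarrow>\<^sub>E F)"
    proof (rule card_inj_on_le[of "\<lambda>x. restrict x (J i)"])
      show "inj_on (\<lambda>x. restrict x (J i)) (T i)"
      proof (rule inj_onI)
        fix x y assume xy: "x \<in> T i" "y \<in> T i" "restrict x (J i) = restrict y (J i)"
        then have "x j = y j" if "j \<in> J i" for j using that by (metis restrict_apply')
        then show "x = y" using xy det[of x y i] by (auto simp: T_def)
      qed
      show "(\<lambda>x. restrict x (J i)) ` T i \<subseteq> J i \<rightarrow>\<^sub>E F"
      proof (rule image_subsetI)
        fix x assume "x \<in> T i"
        then have "x \<in> V" using S(1) by (auto simp: T_def)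
        then show "restrict x (J i) \<in> J i \<rightarrow>\<^sub>E F" using V_F[of x] by auto
      qed
      show "finite (J i \<rightarrow>\<^sub>E F)" using assms(2)[OF i] finite_F by (intro finite_PiE) auto
    qed
    also have "\<dots> = card F ^ card (J i)" using assms(2)[OF i] by (simp add: card_PiE)
    finally show "card (T i) \<le> card F ^ card (J i)" .
  qed
  finally show ?thesis .
qed

end

(* c i is the place of coordinate i on the d-cycle; the pair {0, 1}, at places 0 and d - 1, closes it. *)
locale polygon_geometry = vector_geometry F e N Z
  for F :: "'r :: comm_ring_1 set" and e :: 'r and N :: nat and Z +
  fixes d M :: nat and c :: "nat \<Rightarrow> nat"
  assumes d: "3 \<le> d" and c0: "c 0 = 0" and c1: "c 1 = d - 1"
    and adjacent: "\<And>x y i j. x \<in> V \<Longrightarrow> y \<in> V \<Longrightarrow> Z x x \<Longrightarrow> Z y y \<Longrightarrow> Z x y \<Longrightarrow> is_lead x i \<Longrightarrow> is_lead y j \<Longrightarrow>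
      i \<noteq> j \<Longrightarrow> {i, j} \<noteq> {0, 1} \<Longrightarrow> c i + 1 = c j \<or> c j + 1 = c i"
    and root_line: "\<And>x y. x \<in> L0 \<Longrightarrow> y \<in> L0 \<Longrightarrow> Z x y"
    and root_nbrs: "\<And>w i. w \<in> V \<Longrightarrow> Z (bv 0) w \<Longrightarrow> 3 \<le> i \<Longrightarrow> w i = 0"
    and aut_shear_point: "\<And>t. t \<in> F \<Longrightarrow> \<exists>g\<in>auts. g (bv 0) = bv 0 \<and> g (bv 1) = comb e (bv 1) t (bv 2)"
    and aut_flip_point: "\<exists>g\<in>auts. g (bv 0) = bv 0 \<and> g (bv 1) = bv 2"
    and aut_shear_line: "\<And>t. t \<in> F \<Longrightarrow> \<exists>g\<in>auts. g (bv 0) = comb e (bv 0) t (bv 1) \<and> g (bv 1) = bv 1"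
    and aut_flip_line: "\<exists>g\<in>auts. g (bv 0) = bv 1 \<and> g (bv 1) = bv 0"
    and card_singular: "card {x \<in> V. Z x x \<and> (\<exists>i. is_lead x i \<and> x i = e)} \<le> M"
begin

section \<open>Degrees at the root flag\<close>

lemma flag_Z:
  assumes "(P, L) \<in> flags" "x \<in> L" "y \<in> L"
  shows "Z x y"
proof -
  obtain g where g: "g \<in> auts" "L = g ` L0" using assms by (auto simp: flags_def)
  then obtain x' y' where xy: "x' \<in> L0" "y' \<in> L0" "x = g x'" "y = g y'" using assms by auto
  then show ?thesis using aut_Z[OF g(1)] root_line[OF xy(1,2)] L0_V by blast
qed

text \<open>The shears and the flip fixing \<open>bv 0\<close> produce all the listed lines.
  Conversely \<open>root_nbrs\<close> confines a line through \<open>P0\<close> to the span of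
  \<open>bv 0\<close>, \<open>bv 1\<close>, \<open>bv 2\<close>, and its second generator can be
  normalised modulo \<open>bv 0\<close>.\<close>

lemma lines_through_P0:
  "flags `` {P0} = insert (span2 (bv 0) (bv 2)) ((\<lambda>t. span2 (bv 0) (comb e (bv 1) t (bv 2))) ` F)"
    (is "_ = ?R")
proof (intro subset_antisym subsetI)
  fix L assume "L \<in> ?R"
  then consider "L = span2 (bv 0) (bv 2)" | t where "t \<in> F" "L = span2 (bv 0) (comb e (bv 1) t (bv 2))" by auto
  then obtain g where g: "g \<in> auts" "g (bv 0) = bv 0" "L = span2 (bv 0) (g (bv 1))"
  proof cases
    case 1
    then show ?thesis using that aut_flip_point by auto
  next
    case (2 t)
    then show ?thesis using that aut_shear_point[of t] by auto
  qed
  then have "g ` P0 = P0" "g ` L0 = L"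
    using image_span1[OF g(1), of "bv 0"] image_span2[OF g(1), of "bv 0" "bv 1"]
    by (simp_all add: P0_def L0_def)
  then show "L \<in> flags `` {P0}" using flag_image[OF root_flag g(1)] by simp
next
  fix L assume "L \<in> flags `` {P0}"
  then have "(P0, L) \<in> flags" by simp
  then obtain g where g: "g \<in> auts" "P0 = g ` P0" "L = g ` L0" unfolding flags_def by blast
  define w where "w = g (bv 1)"
  have wV: "w \<in> V" using aut_V[OF g(1)] by (simp add: w_def)
  note wF = V_F[OF wV]
  have L: "L = span2 (g (bv 0)) w" using image_span2[OF g(1), of "bv 0" "bv 1"] by (simp add: g(3) L0_def w_def)
  have wL: "w \<in> L" using wV by (simp add: L in_span2)
  have bvP: "bv 0 \<in> P0" by (simp add: P0_def in_span1)
  have "P0 \<subseteq> L" using g(2,3) P0_L0 by blast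
  then have bvL: "bv 0 \<in> L" using bvP by blast
  have "Z (bv 0) w" using flag_Z[OF \<open>(P0, L) \<in> flags\<close> bvL wL] .
  then have w0: "w i = 0" if "3 \<le> i" for i using root_nbrs[OF wV] that by blast
  have w: "w = comb (w 0) (bv 0) e (comb (w 1) (bv 1) (w 2) (bv 2))"
  proof
    fix i :: nat
    consider "i = 0" | "i = 1" | "i = 2" | "3 \<le> i" by linarith
    then show "w i = comb (w 0) (bv 0) e (comb (w 1) (bv 1) (w 2) (bv 2)) i"
      by cases (use wF w0 in \<open>auto simp: comb_def bv_def\<close>)
  qed
  have gbv: "g (bv 0) \<in> P0" using g(2) bvP by blast
  \<comment> \<open>Modulo \<open>bv 0\<close>, the vectors \<open>y\<close> and \<open>w\<close>
    are multiples of each other, so they span the same line with \<open>bv 0\<close>.\<close>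
  have same: "L = span2 (bv 0) y"
    if y: "y \<in> V" "y = comb s (bv 0) b w" "w = comb (w 0) (bv 0) r y" "s \<in> F" "b \<in> F" "r \<in> F" for y s b r
  proof
    have "w \<in> span2 (bv 0) y" using y span2I[of "w 0" r "bv 0" y] wF by metis
    moreover have "g (bv 0) \<in> span2 (bv 0) y"
      using gbv span1_subset_span2[of "bv 0" "bv 0" y] in_span2[of "bv 0" y] by (auto simp: P0_def)
    ultimately show "L \<subseteq> span2 (bv 0) y" unfolding L by (intro span2_subset)
    have "y \<in> L" unfolding y(2) using bvL wL y unfolding L by (intro comb_in_span2)
    then show "span2 (bv 0) y \<subseteq> L" using bvL unfolding L by (intro span2_subset)
  qed
  show "L \<in> ?R"
  proof (cases "w 1 = 0")
    case False
    then obtain b where b: "b \<in> F" "w 1 * b = e" using inverse_F wF by blast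
    define y where "y = comb e (bv 1) (w 2 * b) (bv 2)"
    have b2: "w 1 * (w 2 * b) = w 2" "b * w 1 = e" "b * w 2 = w 2 * b"
      using b wF by (metis e_mult mult.left_commute mult.commute mult_e)+
    have "L = span2 (bv 0) y"
    proof (rule same)
      show "y \<in> V" using wF b by (simp add: y_def)
      show "w = comb (w 0) (bv 0) (w 1) y"
        by (subst w) (auto simp: comb_def y_def bv_def fun_eq_iff b[unfolded One_nat_def] b2[unfolded One_nat_def] wF)
      show "y = comb (- (b * w 0)) (bv 0) b w"
        by (subst (2) w) (auto simp: comb_def y_def bv_def fun_eq_iff b[unfolded One_nat_def] b2[unfolded One_nat_def] wF)
    qed (use wF b in auto)
    then show ?thesis using wF b by (auto simp: y_def)
  next
    case True
    \<comment> \<open>Otherwise \<open>w\<close>, the image of \<open>bv 1\<close>, would lie in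
      \<open>P0\<close>, which \<open>g\<close> maps onto itself; this contradicts injectivity of
      \<open>g\<close>.\<close>
    have "w 2 \<noteq> 0"
    proof
      assume "w 2 = 0"
      then have "w = comb (w 0) (bv 0) 0 (bv 0)" using True wF by (subst w) (auto simp: comb_def)
      then have "w \<in> P0" unfolding P0_def using span1I wF by metis
      then have "g (bv 1) \<in> g ` P0" using g(2) by (simp only: w_def)
      then obtain z where "z \<in> P0" "g z = g (bv 1)" by (metis imageE)
      then have "bv 1 \<in> P0" using aut_inj[OF g(1)] P0_V bv012(2) by (metis inj_onD subsetD)
      then obtain a where "bv 1 = comb a (bv 0) 0 (bv 0)" by (auto simp: P0_def span1_def)
      then have "bv 1 1 = comb a (bv 0) 0 (bv 0) 1" by simp
      then show False by (simp add: comb_def bv_def)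
    qed
    then obtain b where b: "b \<in> F" "w 2 * b = e" using inverse_F wF by blast
    have b2: "b * w 2 = e" using b by (simp add: mult.commute)
    have "L = span2 (bv 0) (bv 2)"
    proof (rule same)
      show "w = comb (w 0) (bv 0) (w 2) (bv 2)"
        by (subst w) (auto simp: comb_def bv_def fun_eq_iff wF True[simplified])
      show "bv 2 = comb (- (b * w 0)) (bv 0) b w"
        by (subst w) (auto simp: comb_def bv_def fun_eq_iff b b2 wF True[simplified] algebra_simps)
    qed (use wF b in auto)
    then show ?thesis by simp
  qed
qed

lemma card_lines_through_P0: "card (flags `` {P0}) = card F + 1"
proof -
  have coords: "t = t'"
    if t: "t \<in> F" "t' \<in> F" "comb e (bv 1) t' (bv 2) \<in> span2 (bv 0) (comb e (bv 1) t (bv 2))" for t t'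
  proof -
    obtain a b where ab: "a \<in> F" "b \<in> F"
      "comb e (bv 1) t' (bv 2) = comb a (bv 0) b (comb e (bv 1) t (bv 2))"
      using t(3) by (auto simp: span2_def)
    have "b = e" using fun_cong[OF ab(3), of 1] ab by (simp add: comb_def bv_def)
    then show ?thesis using fun_cong[OF ab(3), of 2] t by (simp add: comb_def bv_def)
  qed
  have "inj_on (\<lambda>t. span2 (bv 0) (comb e (bv 1) t (bv 2))) F"
  proof (rule inj_onI)
    fix t t' assume t: "t \<in> F" "t' \<in> F"
      and eq: "span2 (bv 0) (comb e (bv 1) t (bv 2)) = span2 (bv 0) (comb e (bv 1) t' (bv 2))"
    have "comb e (bv 1) t' (bv 2) \<in> span2 (bv 0) (comb e (bv 1) t (bv 2))"
      unfolding eq using t by (intro in_span2) auto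
    then show "t = t'" using coords t by blast
  qed
  moreover have "span2 (bv 0) (bv 2) \<notin> (\<lambda>t. span2 (bv 0) (comb e (bv 1) t (bv 2))) ` F"
  proof
    assume "span2 (bv 0) (bv 2) \<in> (\<lambda>t. span2 (bv 0) (comb e (bv 1) t (bv 2))) ` F"
    then obtain t where t: "t \<in> F" "span2 (bv 0) (bv 2) = span2 (bv 0) (comb e (bv 1) t (bv 2))" by blast
    have "comb e (bv 1) t (bv 2) \<in> span2 (bv 0) (bv 2)"
      unfolding t(2) using t(1) by (intro in_span2) auto
    then obtain a b where "comb e (bv 1) t (bv 2) = comb a (bv 0) b (bv 2)" by (auto simp: span2_def)
    then show False using fun_cong[of _ _ 1] by (fastforce simp: comb_def bv_def)
  qed
  ultimately show ?thesis using finite_F by (simp add: lines_through_P0 card_image)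
qed

text \<open>The maps that stabilise \<open>L0\<close> reach every listed point. Conversely a point
  on \<open>L0\<close> has a generator in the span of \<open>bv 0\<close> and \<open>bv 1\<close>,
  which is normalised at \<open>bv 0\<close> whenever that coefficient is nonzero.\<close>

lemma points_on_L0:
  "flags\<inverse> `` {L0} = insert (span1 (bv 1)) ((\<lambda>t. span1 (comb e (bv 0) t (bv 1))) ` F)"
    (is "_ = ?R")
proof (intro subset_antisym subsetI)
  fix P assume "P \<in> ?R"
  then consider "P = span1 (bv 1)" | t where "t \<in> F" "P = span1 (comb e (bv 0) t (bv 1))" by auto
  then obtain g where g: "g \<in> auts" "P = span1 (g (bv 0))" "span2 (g (bv 0)) (g (bv 1)) = L0"
  proof cases
    case 1
    obtain g where g: "g \<in> auts" "g (bv 0) = bv 1" "g (bv 1) = bv 0" using aut_flip_line by blast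
    have "span2 (bv 1) (bv 0) = L0" unfolding L0_def
      by (intro subset_antisym span2_subset in_span2) auto
    then show ?thesis using that g 1 by auto
  next
    case (2 t)
    obtain g where g: "g \<in> auts" "g (bv 0) = comb e (bv 0) t (bv 1)" "g (bv 1) = bv 1"
      using aut_shear_line[OF 2(1)] by blast
    have sw: "span2 x y = span2 y x" if "x \<in> V" "y \<in> V" for x y
      using that by (intro subset_antisym span2_subset in_span2) auto
    have "comb e (bv 0) t (bv 1) = comb t (bv 1) e (bv 0)" by (auto simp: comb_def add.commute)
    then have "span2 (bv 1) (comb e (bv 0) t (bv 1)) = span2 (bv 1) (bv 0)"
      using span2_shear[of "bv 1" "bv 0" t] 2(1) by simp
    then have "span2 (g (bv 0)) (g (bv 1)) = L0"
      using sw[of "bv 1" "comb e (bv 0) t (bv 1)"] sw[of "bv 1" "bv 0"] 2(1) g by (simp add: L0_def)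
    then show ?thesis using that g 2 by auto
  qed
  then have "g ` P0 = P" "g ` L0 = L0"
    using image_span1[OF g(1), of "bv 0"] image_span2[OF g(1), of "bv 0" "bv 1"]
    by (simp_all add: P0_def L0_def)
  then show "P \<in> flags\<inverse> `` {L0}" using flag_image[OF root_flag g(1)] by simp
next
  fix P assume "P \<in> flags\<inverse> `` {L0}"
  then have "(P, L0) \<in> flags" by simp
  then obtain g where g: "g \<in> auts" "P = g ` P0" "L0 = g ` L0" unfolding flags_def by blast
  have P: "P = span1 (g (bv 0))" using image_span1[OF g(1), of "bv 0"] by (simp add: g P0_def)
  have "bv 0 \<in> L0" by (simp add: L0_def in_span2)
  then have "g (bv 0) \<in> L0" using g(3) by blast
  then obtain a b where ab: "a \<in> F" "b \<in> F" "g (bv 0) = comb a (bv 0) b (bv 1)"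
    by (auto simp: L0_def span2_def)
  have nz: "g (bv 0) \<noteq> (\<lambda>_. 0)" using aut_nonzero[OF g(1)] by simp
  show "P \<in> ?R"
  proof (cases "a = 0")
    case True
    then have "g (bv 0) = comb b (bv 1) 0 (bv 1)" using ab by (auto simp: comb_def)
    then have "g (bv 0) \<in> span1 (bv 1)" using span1I[OF ab(2)] by simp
    then show ?thesis using span1_eq[OF bv012(2) _ nz] P by simp
  next
    case False
    then obtain r where r: "r \<in> F" "a * r = e" using ab inverse_F by blast
    define y where "y = comb e (bv 0) (b * r) (bv 1)"
    have "a * (b * r) = b" using r ab by (metis mult.left_commute mult_e)
    then have "g (bv 0) = comb a y 0 y"
      using ab r by (auto simp: y_def comb_def bv_def fun_eq_iff)
    then have "g (bv 0) \<in> span1 y" using span1I[OF ab(1)] by simp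
    moreover have "y \<in> V" using r ab by (simp add: y_def)
    ultimately have "P = span1 y" using span1_eq[OF _ _ nz] P by simp
    then show ?thesis using r ab by (auto simp: y_def)
  qed
qed

lemma card_points_on_L0: "card (flags\<inverse> `` {L0}) = card F + 1"
proof -
  have "inj_on (\<lambda>t. span1 (comb e (bv 0) t (bv 1))) F"
  proof (rule inj_onI)
    fix t t' assume t: "t \<in> F" "t' \<in> F"
      and eq: "span1 (comb e (bv 0) t (bv 1)) = span1 (comb e (bv 0) t' (bv 1))"
    have "comb e (bv 0) t' (bv 1) \<in> span1 (comb e (bv 0) t (bv 1))"
      unfolding eq using t by (intro in_span1) auto
    then obtain a where a: "a \<in> F"
      "comb e (bv 0) t' (bv 1) = comb a (comb e (bv 0) t (bv 1)) 0 (comb e (bv 0) t (bv 1))"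
      by (auto simp: span1_def)
    have "a = e" using fun_cong[OF a(2), of 0] a(1) by (simp add: comb_def bv_def)
    then show "t = t'" using fun_cong[OF a(2), of 1] t by (simp add: comb_def bv_def)
  qed
  moreover have "span1 (bv 1) \<notin> (\<lambda>t. span1 (comb e (bv 0) t (bv 1))) ` F"
  proof
    assume "span1 (bv 1) \<in> (\<lambda>t. span1 (comb e (bv 0) t (bv 1))) ` F"
    then obtain t where t: "t \<in> F" "span1 (bv 1) = span1 (comb e (bv 0) t (bv 1))" by blast
    have "comb e (bv 0) t (bv 1) \<in> span1 (bv 1)"
      unfolding t(2) using t(1) by (intro in_span1) auto
    then obtain a where a: "comb e (bv 0) t (bv 1) = comb a (bv 1) 0 (bv 1)" by (auto simp: span1_def)
    show False using fun_cong[OF a, of 0] by (simp add: comb_def bv_def)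
  qed
  ultimately show ?thesis using finite_F by (simp add: points_on_L0 card_image)
qed

end

section \<open>The incidence graph and its girth\<close>

context polygon_geometry
begin

definition edges :: "((nat \<Rightarrow> 'r) set + (nat \<Rightarrow> 'r) set) rel" where
  "edges = {(Inl P, Inr L) | P L. (P, L) \<in> flags} \<union> {(Inr L, Inl P) | P L. (P, L) \<in> flags}"

definition vertices :: "((nat \<Rightarrow> 'r) set + (nat \<Rightarrow> 'r) set) set" where
  "vertices = Inl ` Domain flags \<union> Inr ` Range flags"

lemma edges_iff [simp]:
  "(Inl P, Inr L) \<in> edges \<longleftrightarrow> (P, L) \<in> flags" "(Inr L, Inl P) \<in> edges \<longleftrightarrow> (P, L) \<in> flags"
  "(Inl P, Inl P') \<notin> edges" "(Inr L, Inr L') \<notin> edges"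
  by (auto simp: edges_def)

lemma edges_cases:
  assumes "(a, b) \<in> edges"
  obtains P L where "(P, L) \<in> flags" "a = Inl P" "b = Inr L" | P L where "(P, L) \<in> flags" "a = Inr L" "b = Inl P"
  using assms by (auto simp: edges_def)

lemma sym_edges: "sym edges"
  by (auto simp: edges_def sym_def)

lemma edges_vertices: "edges \<subseteq> vertices \<times> vertices"
  by (auto simp: edges_def vertices_def)

lemma finite_flags: "finite flags"
proof (rule finite_subset)
  show "flags \<subseteq> Pow V \<times> Pow V" by (rule subrelI) (simp add: flag_V)
  show "finite (Pow V \<times> Pow V)" using finite_V by simp
qed

lemma finite_vertices: "finite vertices"
  using finite_flags by (simp add: vertices_def finite_Domain finite_Range)

lemma degree:
  assumes "a \<in> vertices"
  shows "card (edges `` {a}) = card F + 1"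
proof -
  consider P L where "(P, L) \<in> flags" "a = Inl P" | P L where "(P, L) \<in> flags" "a = Inr L"
    using assms by (auto simp: vertices_def)
  then show ?thesis
  proof cases
    case (1 P L)
    have "edges `` {a} = Inr ` (flags `` {P})" using 1 by (auto elim: edges_cases)
    then show ?thesis using card_lines_through[OF 1(1)] card_lines_through_P0 by (simp add: card_image)
  next
    case (2 P L)
    have "edges `` {a} = Inl ` (flags\<inverse> `` {L})" using 2 by (auto elim: edges_cases)
    then show ?thesis using card_points_on[OF 2(1)] card_points_on_L0 by (simp add: card_image)
  qed
qed

text \<open>Each point is spanned by a singular vector with leading coefficient \<open>e\<close>, so
  \<open>card_singular\<close> bounds the orbit without identifying it.\<close>

lemma card_points: "card (Domain flags) \<le> M"
proof -
  define S where "S = {x \<in> V. Z x x \<and> (\<exists>i. is_lead x i \<and> x i = e)}"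
  have "finite S" using finite_V by (simp add: S_def)
  have "Domain flags \<subseteq> span1 ` S"
  proof
    fix P assume "P \<in> Domain flags"
    then obtain L where PL: "(P, L) \<in> flags" by blast
    then obtain g where g: "g \<in> auts" "P = g ` P0" by (auto simp: flags_def)
    define x where "x = g (bv 0)"
    have x: "x \<in> V" "x \<noteq> (\<lambda>_. 0)" using aut_V[OF g(1)] aut_nonzero[OF g(1)] by (auto simp: x_def)
    have P: "P = span1 x" using image_span1[OF g(1), of "bv 0"] by (simp add: g P0_def x_def)
    obtain i where i: "is_lead x i" using exists_lead[OF x] by blast
    then obtain b where b: "b \<in> F" "x i * b = e"
      using inverse_F[OF V_F[OF x(1)], of i] by (auto simp: is_lead_def)
    define y where "y = comb b x 0 x"
    have yP: "y \<in> P" using b by (simp add: P y_def span1I)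
    have yi: "y i = e" using b by (simp add: y_def comb_def mult.commute)
    then have "is_lead y i" using i by (auto simp: is_lead_def y_def comb_def)
    moreover have "P \<subseteq> L"
    proof -
      obtain h where "P = h ` P0" "L = h ` L0" using PL by (auto simp: flags_def)
      then show ?thesis using P0_L0 by blast
    qed
    then have "Z y y" using flag_Z[OF PL] yP by blast
    moreover have "y \<in> V" using yP flag_V(1)[OF PL] by blast
    ultimately have "y \<in> S" using yi by (auto simp: S_def)
    moreover have "y \<noteq> (\<lambda>_. 0)" using yi e_nz by metis
    then have "P = span1 y" using span1_eq[OF x(1), of y] yP P by simp
    ultimately show "P \<in> span1 ` S" by blast
  qed
  then have "card (Domain flags) \<le> card (span1 ` S)" using \<open>finite S\<close> by (intro card_mono) auto
  also have "\<dots> \<le> card S" using \<open>finite S\<close> by (rule card_image_le)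
  finally show ?thesis using card_singular by (simp add: S_def)
qed

text \<open>Double counting of flags: both sides have degree \<open>card F + 1\<close>, so the bound
  on points carries over to lines.\<close>

lemma card_lines: "card (Range flags) = card (Domain flags)"
proof -
  have fin: "finite (flags `` {P})" "finite (flags\<inverse> `` {L})" for P L
    using finite_flags by (simp_all add: finite_Image)
  have deg_P: "card (flags `` {P}) = card F + 1" if P: "P \<in> Domain flags" for P
  proof -
    obtain L where "(P, L) \<in> flags" using P by blast
    then show ?thesis using card_lines_through card_lines_through_P0 by simp
  qed
  have deg_L: "card (flags\<inverse> `` {L}) = card F + 1" if L: "L \<in> Range flags" for L
  proof -
    obtain P where "(P, L) \<in> flags" using L by blast
    then show ?thesis using card_points_on card_points_on_L0 by simp
  qed
  have "card flags = card (SIGMA P:Domain flags. flags `` {P})"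
    by (intro arg_cong[of _ _ card]) auto
  also have "\<dots> = (\<Sum>P\<in>Domain flags. card (flags `` {P}))"
    using fin finite_flags by (intro card_SigmaI) (auto simp: finite_Domain)
  also have "\<dots> = card (Domain flags) * (card F + 1)"
    using deg_P by simp
  finally have 1: "card flags = card (Domain flags) * (card F + 1)" .
  have "card (flags\<inverse>) = card (SIGMA L:Range flags. flags\<inverse> `` {L})"
    by (intro arg_cong[of _ _ card]) auto
  also have "\<dots> = (\<Sum>L\<in>Range flags. card (flags\<inverse> `` {L}))"
    using fin finite_flags by (intro card_SigmaI) (auto simp: finite_Range)
  also have "\<dots> = card (Range flags) * (card F + 1)"
    using deg_L by simp
  finally have "card flags = card (Range flags) * (card F + 1)" by (simp add: card_inverse)
  then show ?thesis using 1 by (metis Suc_eq_plus1 mult_cancel2 nat.distinct(1))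
qed

lemma card_vertices: "card vertices \<le> 2 * M"
proof -
  have "card vertices \<le> card (Inl ` Domain flags :: ((nat \<Rightarrow> 'r) set + (nat \<Rightarrow> 'r) set) set)
      + card (Inr ` Range flags :: ((nat \<Rightarrow> 'r) set + (nat \<Rightarrow> 'r) set) set)"
    unfolding vertices_def by (rule card_Un_le)
  then show ?thesis using card_points card_lines by (simp add: card_image)
qed

text \<open>The \<open>d\<close>-cycle of positions, subdivided by lines and cut open at the root
  edge. A point at place \<open>c i\<close> gets \<open>2 * c i\<close>, and a line over two
  neighbouring places the midpoint \<open>c i + c j\<close>. For the closing pair the midpoint would
  be wrong; the value \<open>2 * d - 1\<close> puts \<open>L0\<close> one above the points at
  position 1, and \<open>2 * d - 1\<close> above \<open>P0\<close>.\<close>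

definition level :: "(nat \<Rightarrow> 'r) set + (nat \<Rightarrow> 'r) set \<Rightarrow> int" where
  "level a = (case a of Inl P \<Rightarrow> (\<Sum>i\<in>leads P. 2 * int (c i))
     | Inr L \<Rightarrow> if leads L = {0, 1} then 2 * int d - 1 else (\<Sum>i\<in>leads L. int (c i)))"

text \<open>A point of \<open>L0\<close> other than \<open>P0\<close> has position 1. On any other
  line the two positions are neighbours, so each point differs from the midpoint by 1.\<close>

lemma level_flag:
  assumes PL: "(P, L) \<in> flags" "(P, L) \<noteq> (P0, L0)"
  shows "\<bar>level (Inl P) - level (Inr L)\<bar> \<le> 1"
proof -
  obtain i j where ij: "i \<noteq> j" "leads P = {i}" "leads L = {i, j}" using flag_leads[OF PL(1)] by blast
  have P: "level (Inl P) = 2 * int (c i)" by (simp add: level_def ij)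
  show ?thesis
  proof (cases "{i, j} = {0, 1}")
    case True
    then have "L = L0" using flag_L0[OF PL(1)] ij by simp
    then have "i \<noteq> 0" using flag_P0[OF PL(1)] ij PL(2) by auto
    then have "i = 1" using True by (auto simp: doubleton_eq_iff)
    then show ?thesis using P True d c1 by (simp add: level_def ij of_nat_diff)
  next
    case False
    have "i \<in> leads L" "j \<in> leads L" using ij(3) by auto
    then obtain x y where xy: "x \<in> L" "is_lead x i" "y \<in> L" "is_lead y j"
      by (auto simp: leads_def)
    have V: "x \<in> V" "y \<in> V" using xy flag_V(2)[OF PL(1)] by auto
    have "c i + 1 = c j \<or> c j + 1 = c i"
      using adjacent[OF V flag_Z[OF PL(1) xy(1,1)] flag_Z[OF PL(1) xy(3,3)] flag_Z[OF PL(1) xy(1,3)]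
          xy(2,4) ij(1) False] .
    moreover have "level (Inr L) = int (c i) + int (c j)"
      unfolding level_def sum.case ij(3) if_not_P[OF False] using ij(1) by simp
    ultimately show ?thesis using P by linarith
  qed
qed

lemma leads_root: "leads P0 = {0}" "leads L0 = {0, 1}"
proof -
  have 0: "is_lead (bv 0) 0" "is_lead (bv 1) 1" by (auto simp: is_lead_def bv_def)
  show "leads P0 = {0}" unfolding P0_def by (rule leads_span1) (use 0 in auto)
  show "leads L0 = {0, 1}" unfolding L0_def by (rule leads_span2) (use 0 in auto)
qed

text \<open>An automorphism taking a given edge to the root edge carries \<open>level\<close> back
  to it; the reversed arc is certified by the negative of that function.\<close>

lemma girth_edges: "girth_certified (2 * d) edges"
  unfolding girth_certified_def
proof (intro allI impI)
  have main: "\<exists>f. int_lipschitz (edges - {(Inl P, Inr L), (Inr L, Inl P)}) f \<and>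
      f (Inr L) - f (Inl P) = int (2 * d) - 1" if PL: "(P, L) \<in> flags" for P L
  proof -
    obtain g where g: "g \<in> auts" "P = g ` P0" "L = g ` L0" using PL by (auto simp: flags_def)
    obtain h where h: "h \<in> auts" "\<forall>x\<in>V. h (g x) = x" "\<forall>x\<in>V. g (h x) = x"
      using aut_inverse[OF g(1)] by blast
    define f where "f a = level (map_sum ((`) h) ((`) h) a)" for a
    have hP: "h ` P = P0" using image_inverse[of h g, OF h(2) P0_V] g by simp
    have hL: "h ` L = L0" using image_inverse[of h g, OF h(2) L0_V] g by simp
    have "\<bar>f (Inl P') - f (Inr L')\<bar> \<le> 1" if P'L': "(P', L') \<in> flags" "(P', L') \<noteq> (P, L)" for P' L'
    proof -
      have "(h ` P', h ` L') \<noteq> (P0, L0)"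
      proof
        assume "(h ` P', h ` L') = (P0, L0)"
        then have "g ` h ` P' = P" "g ` h ` L' = L" using g by auto
        then show False
          using image_inverse[of g h, OF h(3) flag_V(1)[OF P'L'(1)]]
            image_inverse[of g h, OF h(3) flag_V(2)[OF P'L'(1)]] P'L'(2) by simp
      qed
      then show ?thesis using level_flag[OF flag_image[OF P'L'(1) h(1)]] by (simp add: f_def)
    qed
    note lip = this
    have "int_lipschitz (edges - {(Inl P, Inr L), (Inr L, Inl P)}) f"
    proof (rule int_lipschitzI)
      fix a b assume "(a, b) \<in> edges - {(Inl P, Inr L), (Inr L, Inl P)}"
      then have ab: "(a, b) \<in> edges" "(a, b) \<noteq> (Inl P, Inr L)" "(a, b) \<noteq> (Inr L, Inl P)" by blast+
      from ab(1) show "\<bar>f a - f b\<bar> \<le> 1"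
      proof (cases rule: edges_cases)
        case (1 P' L')
        then show ?thesis using lip[of P' L'] ab(2) by simp
      next
        case (2 P' L')
        then have "(P', L') \<noteq> (P, L)" using ab(3) by blast
        then show ?thesis using lip[OF 2(1)] 2 by (simp add: abs_minus_commute)
      qed
    qed
    moreover have "f (Inr L) - f (Inl P) = int (2 * d) - 1"
      using leads_root c0 by (simp add: f_def hP hL level_def)
    ultimately show ?thesis by blast
  qed
  fix a b assume "(a, b) \<in> edges"
  then show "\<exists>f. int_lipschitz (edges - {(a, b), (b, a)}) f \<and> f b - f a = int (2 * d) - 1"
  proof (cases rule: edges_cases)
    case (1 P L)
    then show ?thesis using main by simp
  next
    case (2 P L)
    obtain f where f: "int_lipschitz (edges - {(Inl P, Inr L), (Inr L, Inl P)}) f"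
      "f (Inr L) - f (Inl P) = int (2 * d) - 1" using main[OF 2(1)] by blast
    have "int_lipschitz (edges - {(a, b), (b, a)}) (\<lambda>x. - f x)"
    proof (rule int_lipschitzI)
      fix x y assume "(x, y) \<in> edges - {(a, b), (b, a)}"
      then have "\<bar>f x - f y\<bar> \<le> 1" using f(1) 2 by (intro int_lipschitzD[OF f(1)]) auto
      then show "\<bar>- f x - - f y\<bar> \<le> 1" by simp
    qed
    then show ?thesis using f(2) 2 by (intro exI[of _ "\<lambda>x. - f x"]) simp
  qed
qed

lemma polygon_radius_family:
  "\<exists>n :: nat \<Rightarrow> nat. filterlim n at_top sequentially \<and>
    (\<forall>i. radii (n i) (card F + 1) (2 * d) \<noteq> {} \<and>
       real (max_radius (n i) (card F + 1) (2 * d)) \<ge> real d * real (n i) / (2 * real M) - real d)"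
proof (rule long_radius_family[OF finite_vertices edges_vertices sym_edges])
  show "(Inl P0, Inr L0) \<in> edges" using root_flag by simp
  show "isl a \<noteq> isl b" if "(a, b) \<in> edges" for a b using that by (auto elim: edges_cases)
  have "0 < card F" using finite_F zero_F card_gt_0_iff by blast
  then show "2 \<le> card F + 1" by simp
qed (use degree girth_edges d card_vertices in auto)

end

section \<open>The three geometries\<close>

definition vec :: "'r :: zero list \<Rightarrow> nat \<Rightarrow> 'r" where
  "vec xs i = (if i < length xs then xs ! i else 0)"

lemma vec_simps [simp]:
  "vec [] i = 0" "vec (x # xs) 0 = x" "vec (x # xs) (Suc i) = vec xs i"
  "vec (x # xs) (numeral k) = vec xs (numeral k - 1)"
  by (auto simp: vec_def nth_Cons' numeral_eq_Suc)

context vector_geometry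
begin

lemma vec_V: "length xs = N \<Longrightarrow> set xs \<subseteq> F \<Longrightarrow> vec xs \<in> V"
  by (auto simp: V_def vec_def)

lemma vec_map_upt: "x \<in> V \<Longrightarrow> vec (map x [0..<N]) = x"
  by (auto simp: V_def vec_def fun_eq_iff)

lemma vec_eqI: "x \<in> V \<Longrightarrow> y \<in> V \<Longrightarrow> (\<And>i. i < N \<Longrightarrow> x i = y i) \<Longrightarrow> x = y"
  using V_0[of x] V_0[of y] by (metis ext not_le)

text \<open>For an explicit matrix and its inverse, linearity and inversion become identities
  between coordinate lists that simplification can check.\<close>

lemma lin_aut:
  assumes g: "\<And>x. g x = vec (G x)" and h: "\<And>x. h x = vec (H x)"
    and len: "\<And>x. length (G x) = N" "\<And>x. length (H x) = N"
    and F: "\<And>x. \<forall>i. x i \<in> F \<Longrightarrow> set (G x) \<subseteq> F" "\<And>x. \<forall>i. x i \<in> F \<Longrightarrow> set (H x) \<subseteq> F"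
    and lin: "\<And>x y a b. G (comb a x b y) = map2 (\<lambda>s t. a * s + b * t) (G x) (G y)"
      "\<And>x y a b. H (comb a x b y) = map2 (\<lambda>s t. a * s + b * t) (H x) (H y)"
    and Z: "\<And>x y. Z x y \<Longrightarrow> Z (g x) (g y)" "\<And>x y. Z x y \<Longrightarrow> Z (h x) (h y)"
    and inv: "\<And>x. H (vec (G x)) = map x [0..<N]" "\<And>x. G (vec (H x)) = map x [0..<N]"
  shows "g \<in> auts"
proof (rule autsI[of g h])
  have comb_vec: "comb a (vec xs) b (vec ys) = vec (map2 (\<lambda>s t. a * s + b * t) xs ys)"
    if "length xs = length ys" for a b xs ys
    using that by (auto simp: comb_def vec_def fun_eq_iff)
  have V: "vec (G x) \<in> V" "vec (H x) \<in> V" if "x \<in> V" for x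
    using len F[of x] V_F[OF that] by (auto intro!: vec_V)
  show "morph g" unfolding morph_def using Z(1) V by (auto simp: g lin comb_vec len)
  show "morph h" unfolding morph_def using Z(2) V by (auto simp: h lin comb_vec len)
qed (use inv in \<open>simp_all add: g h vec_map_upt\<close>)

lemma lead_less: "x \<in> V \<Longrightarrow> is_lead x i \<Longrightarrow> i < N"
  using V_0[of x i] by (auto simp: is_lead_def not_le[symmetric])

lemma lead_mult_nz: "x \<in> V \<Longrightarrow> y \<in> V \<Longrightarrow> is_lead x i \<Longrightarrow> is_lead y j \<Longrightarrow> x i * y j \<noteq> 0"
  using mult_eq_0_F[OF V_F[of x i] V_F[of y j]] by (auto simp: is_lead_def)

text \<open>With leading coefficient \<open>e\<close> at position \<open>i\<close>, just the
  \<open>i\<close> coordinates below remain free.\<close>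

lemma card_monic_le:
  "card {x \<in> V. (\<exists>i. is_lead x i \<and> x i = e)} \<le> (\<Sum>i<N. card F ^ i)"
proof -
  have "card {x \<in> V. (\<exists>i. is_lead x i \<and> x i = e)} \<le> (\<Sum>i<N. card F ^ card {..<i})"
  proof (rule card_normalised_le)
    fix x y i
    assume x: "x \<in> {x \<in> V. \<exists>i. is_lead x i \<and> x i = e}" "is_lead x i"
      and y: "y \<in> {x \<in> V. \<exists>i. is_lead x i \<and> x i = e}" "is_lead y i"
      and eq: "\<And>j. j \<in> {..<i} \<Longrightarrow> x j = y j"
    have "x i = e" "y i = e" using x y is_lead_unique by blast+
    then show "x = y" using x(2) y(2) eq
      by (intro ext) (metis is_lead_def lessThan_iff linorder_neqE_nat)
  qed (auto intro: lead_less)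
  then show ?thesis by simp
qed

end

context corner_field
begin

text \<open>On a triangle any two places are neighbours, so no relation has to exclude a pair. The
  cyclic order 0, 2, 1 puts the closing pair at the two ends.\<close>

lemma projective_plane:
  "polygon_geometry F e 3 (\<lambda>_ _. True) 3 (1 + card F + card F ^ 2) ((!) [0, 2, 1])"
proof -
  interpret vector_geometry F e 3 "\<lambda>_ _. True" by unfold_locales simp
  have shear_point: "(\<lambda>x. vec [x 0, x 1, x 2 + t * x 1]) \<in> auts" if "t \<in> F" for t
    using that by (intro lin_aut[where G = "\<lambda>x. [x 0, x 1, x 2 + t * x 1]" and H = "\<lambda>x. [x 0, x 1, x 2 - t * x 1]" and h = "\<lambda>x. vec [x 0, x 1, x 2 - t * x 1]"])
      (auto simp: comb_def algebra_simps upt_rec eval_nat_numeral)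
  have flip_point: "(\<lambda>x. vec [x 0, x 2, x 1]) \<in> auts"
    by (intro lin_aut[where G = "\<lambda>x. [x 0, x 2, x 1]" and H = "\<lambda>x. [x 0, x 2, x 1]" and h = "\<lambda>x. vec [x 0, x 2, x 1]"])
      (auto simp: comb_def algebra_simps upt_rec eval_nat_numeral)
  have shear_line: "(\<lambda>x. vec [x 0, x 1 + t * x 0, x 2]) \<in> auts" if "t \<in> F" for t
    using that by (intro lin_aut[where G = "\<lambda>x. [x 0, x 1 + t * x 0, x 2]" and H = "\<lambda>x. [x 0, x 1 - t * x 0, x 2]" and h = "\<lambda>x. vec [x 0, x 1 - t * x 0, x 2]"])
      (auto simp: comb_def algebra_simps upt_rec eval_nat_numeral)
  have flip_line: "(\<lambda>x. vec [x 1, x 0, x 2]) \<in> auts"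
    by (intro lin_aut[where G = "\<lambda>x. [x 1, x 0, x 2]" and H = "\<lambda>x. [x 1, x 0, x 2]" and h = "\<lambda>x. vec [x 1, x 0, x 2]"])
      (auto simp: comb_def algebra_simps upt_rec eval_nat_numeral)
  have lt: "i = 0 \<or> i = 1 \<or> i = 2" if "i < 3" for i :: nat using that by auto
  show ?thesis
  proof
    show "\<exists>g\<in>auts. g (bv 0) = bv 0 \<and> g (bv 1) = comb e (bv 1) t (bv 2)" if t: "t \<in> F" for t
      by (rule bexI[OF _ shear_point[OF t]]) (use t in \<open>auto simp: bv_def comb_def fun_eq_iff vec_def nth_Cons'\<close>)
    show "\<exists>g\<in>auts. g (bv 0) = bv 0 \<and> g (bv 1) = bv 2"
      by (rule bexI[OF _ flip_point]) (auto simp: bv_def fun_eq_iff vec_def nth_Cons')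
    show "\<exists>g\<in>auts. g (bv 0) = comb e (bv 0) t (bv 1) \<and> g (bv 1) = bv 1" if t: "t \<in> F" for t
      by (rule bexI[OF _ shear_line[OF t]]) (use t in \<open>auto simp: bv_def comb_def fun_eq_iff vec_def nth_Cons'\<close>)
    show "\<exists>g\<in>auts. g (bv 0) = bv 1 \<and> g (bv 1) = bv 0"
      by (rule bexI[OF _ flip_line]) (auto simp: bv_def fun_eq_iff vec_def nth_Cons')
    show "([0, 2, 1] ! i :: nat) + 1 = [0, 2, 1] ! j \<or> ([0, 2, 1] ! j :: nat) + 1 = [0, 2, 1] ! i"
      if xy: "x \<in> V" "y \<in> V" "is_lead x i" "is_lead y j" "i \<noteq> j" "{i, j} \<noteq> {0, 1}" for x y i j
    proof -
      have "i < 3" "j < 3" using lead_less xy by auto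
      then show ?thesis using xy(5,6) by (auto dest!: lt)
    qed
    show "w i = 0" if "w \<in> V" "3 \<le> i" for w i using that V_0 by blast
    show "card {x \<in> V. True \<and> (\<exists>i. is_lead x i \<and> x i = e)} \<le> 1 + card F + card F ^ 2"
      using card_monic_le by (auto simp: eval_nat_numeral)
  qed auto
qed

text \<open>The cyclic order is 0, 2, 3, 1. Its opposite pairs \<open>{0, 3}\<close> and
  \<open>{1, 2}\<close> are the hyperbolic pairs of the form: for vectors leading there the form
  reduces to \<open>x i * y j\<close> up to sign, which is nonzero. As the form is alternating, all
  points of projective 3-space are singular.\<close>

lemma symplectic_quadrangle:
  "polygon_geometry F e 4 (\<lambda>x y. x 0 * y 3 - x 3 * y 0 + x 1 * y 2 - x 2 * y 1 = 0) 4
     (1 + card F + card F ^ 2 + card F ^ 3) ((!) [0, 3, 1, 2])"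
proof -
  interpret vector_geometry F e 4 "\<lambda>x y. x 0 * y 3 - x 3 * y 0 + x 1 * y 2 - x 2 * y 1 = 0"
    by unfold_locales simp
  have shear_point: "(\<lambda>x. vec [x 0, x 1, x 2 + t * x 1, x 3]) \<in> auts" if "t \<in> F" for t
    using that by (intro lin_aut[where G = "\<lambda>x. [x 0, x 1, x 2 + t * x 1, x 3]" and H = "\<lambda>x. [x 0, x 1, x 2 - t * x 1, x 3]" and h = "\<lambda>x. vec [x 0, x 1, x 2 - t * x 1, x 3]"])
      (auto simp: comb_def algebra_simps upt_rec eval_nat_numeral)
  have flip_point: "(\<lambda>x. vec [x 0, - x 2, x 1, x 3]) \<in> auts"
    by (intro lin_aut[where G = "\<lambda>x. [x 0, - x 2, x 1, x 3]" and H = "\<lambda>x. [x 0, x 2, - x 1, x 3]" and h = "\<lambda>x. vec [x 0, x 2, - x 1, x 3]"])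
      (auto simp: comb_def algebra_simps upt_rec eval_nat_numeral)
  have shear_line: "(\<lambda>x. vec [x 0, x 1 + t * x 0, x 2, x 3 - t * x 2]) \<in> auts" if "t \<in> F" for t
    using that by (intro lin_aut[where G = "\<lambda>x. [x 0, x 1 + t * x 0, x 2, x 3 - t * x 2]" and H = "\<lambda>x. [x 0, x 1 - t * x 0, x 2, x 3 + t * x 2]" and h = "\<lambda>x. vec [x 0, x 1 - t * x 0, x 2, x 3 + t * x 2]"])
      (auto simp: comb_def algebra_simps upt_rec eval_nat_numeral)
  have flip_line: "(\<lambda>x. vec [x 1, x 0, x 3, x 2]) \<in> auts"
    by (intro lin_aut[where G = "\<lambda>x. [x 1, x 0, x 3, x 2]" and H = "\<lambda>x. [x 1, x 0, x 3, x 2]" and h = "\<lambda>x. vec [x 1, x 0, x 3, x 2]"])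
      (auto simp: comb_def algebra_simps upt_rec eval_nat_numeral)
  have lt: "i = 0 \<or> i = 1 \<or> i = 2 \<or> i = 3" if "i < 4" for i :: nat using that by auto
  show ?thesis
  proof
    show "\<exists>g\<in>auts. g (bv 0) = bv 0 \<and> g (bv 1) = comb e (bv 1) t (bv 2)" if t: "t \<in> F" for t
      by (rule bexI[OF _ shear_point[OF t]]) (use t in \<open>auto simp: bv_def comb_def fun_eq_iff vec_def nth_Cons'\<close>)
    show "\<exists>g\<in>auts. g (bv 0) = bv 0 \<and> g (bv 1) = bv 2"
      by (rule bexI[OF _ flip_point]) (auto simp: bv_def fun_eq_iff vec_def nth_Cons')
    show "\<exists>g\<in>auts. g (bv 0) = comb e (bv 0) t (bv 1) \<and> g (bv 1) = bv 1" if t: "t \<in> F" for t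
      by (rule bexI[OF _ shear_line[OF t]]) (use t in \<open>auto simp: bv_def comb_def fun_eq_iff vec_def nth_Cons'\<close>)
    show "\<exists>g\<in>auts. g (bv 0) = bv 1 \<and> g (bv 1) = bv 0"
      by (rule bexI[OF _ flip_line]) (auto simp: bv_def fun_eq_iff vec_def nth_Cons')
    show "([0, 3, 1, 2] ! i :: nat) + 1 = [0, 3, 1, 2] ! j \<or> ([0, 3, 1, 2] ! j :: nat) + 1 = [0, 3, 1, 2] ! i"
      if xy: "x \<in> V" "y \<in> V" "x 0 * y 3 - x 3 * y 0 + x 1 * y 2 - x 2 * y 1 = 0" "is_lead x i" "is_lead y j" "i \<noteq> j" "{i, j} \<noteq> {0, 1}" for x y i j
    proof -
      have ij: "i < 4" "j < 4" using lead_less xy by auto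
      have nz: "x i * y j \<noteq> 0" using lead_mult_nz xy by blast
      have 0: "i < k \<Longrightarrow> x k = 0" "j < k \<Longrightarrow> y k = 0" for k using xy by (auto simp: is_lead_def)
      show ?thesis
        using lt[OF ij(1)] lt[OF ij(2)]
        by (elim disjE) (use xy(3,6,7) nz in \<open>simp_all add: 0 insert_commute mult.commute\<close>)
    qed
    show "x 0 * y 3 - x 3 * y 0 + x 1 * y 2 - x 2 * y 1 = 0" if "x \<in> L0" "y \<in> L0" for x y
      using that by (auto simp: L0_def span2_def comb_def bv_def)
    show "w i = 0" if w: "w \<in> V" "bv 0 0 * w 3 - bv 0 3 * w 0 + bv 0 1 * w 2 - bv 0 2 * w 1 = 0" "3 \<le> i" for w i
      using w(2) V_F[OF w(1)] V_0[OF w(1), of i] w(3) by (cases "i = 3") (auto simp: bv_def)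
    show "card {x \<in> V. x 0 * x 3 - x 3 * x 0 + x 1 * x 2 - x 2 * x 1 = 0 \<and> (\<exists>i. is_lead x i \<and> x i = e)}
        \<le> 1 + card F + card F ^ 2 + card F ^ 3"
      using card_monic_le by (auto simp: eval_nat_numeral mult.commute)
  qed auto
qed

end

text \<open>The product of the trace-zero octonions with Zorn vector matrices
  \<open>(a, u; v, -a)\<close> and \<open>(b, u'; v', -b)\<close>, where the coordinates are ordered as
  \<open>u1, v2, v3, a, u3, u2, v1\<close>, i.e. by decreasing height of the short roots of \<open>G2\<close>.\<close>

definition zorn :: "(nat \<Rightarrow> 'r :: comm_ring_1) \<Rightarrow> (nat \<Rightarrow> 'r) \<Rightarrow> 'r list" where
  "zorn x y =
    [x 3 * y 3 + x 0 * y 6 + x 5 * y 1 + x 4 * y 2,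
     x 3 * y 0 - y 3 * x 0 - (x 1 * y 2 - x 2 * y 1),
     x 3 * y 5 - y 3 * x 5 - (x 2 * y 6 - x 6 * y 2),
     x 3 * y 4 - y 3 * x 4 - (x 6 * y 1 - x 1 * y 6),
     y 3 * x 6 - x 3 * y 6 + (x 5 * y 4 - x 4 * y 5),
     y 3 * x 1 - x 3 * y 1 + (x 4 * y 0 - x 0 * y 4),
     y 3 * x 2 - x 3 * y 2 + (x 0 * y 5 - x 5 * y 0),
     x 3 * y 3 + x 6 * y 0 + x 1 * y 5 + x 2 * y 4]"

context corner_field
begin

text \<open>The cyclic order 0, 2, 5, 6, 4, 1 is the hexagon of short roots. A pair of positions two
  apart is excluded by one of the six cross-product entries of \<open>zorn\<close>, a pair of
  opposite ones by the first or the last entry: for the leading positions \<open>i\<close> and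
  \<open>j\<close> some entry reduces to \<open>x i * y j\<close> up to sign.\<close>

lemma split_cayley_hexagon:
  "polygon_geometry F e 7 (\<lambda>x y. zorn x y = [0, 0, 0, 0, 0, 0, 0, 0]) 6
     (1 + card F + card F ^ 2 + card F ^ 3 + card F ^ 4 + card F ^ 5) ((!) [0, 5, 1, 0, 4, 2, 3])"
proof -
  interpret vector_geometry F e 7 "\<lambda>x y. zorn x y = [0, 0, 0, 0, 0, 0, 0, 0]"
    by unfold_locales simp
  \<comment> \<open>\<open>SL3\<close> acts on the vectors \<open>u\<close> and contragrediently on
    \<open>v\<close>; this shear and the flip after it are of that kind. The product of the images
    is a linear image of the product, hence vanishes with it; the same device serves all the maps
    below.\<close>
  have shear_point_a: "zorn (vec [x 0, x 1, x 2 + t * x 1, x 3, x 4, x 5 - t * x 4, x 6]) (vec [y 0, y 1, y 2 + t * y 1, y 3, y 4, y 5 - t * y 4, y 6]) = [0, 0, 0, 0, 0, 0, 0, 0]"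
    if "zorn x y = [0, 0, 0, 0, 0, 0, 0, 0]" for x y :: "nat \<Rightarrow> 'r" and t
  proof -
    have "zorn (vec [x 0, x 1, x 2 + t * x 1, x 3, x 4, x 5 - t * x 4, x 6]) (vec [y 0, y 1, y 2 + t * y 1, y 3, y 4, y 5 - t * y 4, y 6]) =
      (case zorn x y of [a, u1, u2, u3, v1, v2, v3, b] \<Rightarrow> [a, u1, u2 - t * u3, u3, v1, v2, v3 + t * v2, b])"
      by (simp add: zorn_def algebra_simps)
    then show ?thesis by (simp add: that)
  qed
  have shear_point_b: "zorn (vec [x 0, x 1, x 2 - t * x 1, x 3, x 4, x 5 + t * x 4, x 6]) (vec [y 0, y 1, y 2 - t * y 1, y 3, y 4, y 5 + t * y 4, y 6]) = [0, 0, 0, 0, 0, 0, 0, 0]"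
    if "zorn x y = [0, 0, 0, 0, 0, 0, 0, 0]" for x y :: "nat \<Rightarrow> 'r" and t
  proof -
    have "zorn (vec [x 0, x 1, x 2 - t * x 1, x 3, x 4, x 5 + t * x 4, x 6]) (vec [y 0, y 1, y 2 - t * y 1, y 3, y 4, y 5 + t * y 4, y 6]) =
      (case zorn x y of [a, u1, u2, u3, v1, v2, v3, b] \<Rightarrow> [a, u1, u2 + t * u3, u3, v1, v2, v3 - t * v2, b])"
      by (simp add: zorn_def algebra_simps)
    then show ?thesis by (simp add: that)
  qed
  have shear_point: "(\<lambda>x. vec [x 0, x 1, x 2 + t * x 1, x 3, x 4, x 5 - t * x 4, x 6]) \<in> auts" if "t \<in> F" for t
    using that by (intro lin_aut[where G = "\<lambda>x. [x 0, x 1, x 2 + t * x 1, x 3, x 4, x 5 - t * x 4, x 6]" and H = "\<lambda>x. [x 0, x 1, x 2 - t * x 1, x 3, x 4, x 5 + t * x 4, x 6]" and h = "\<lambda>x. vec [x 0, x 1, x 2 - t * x 1, x 3, x 4, x 5 + t * x 4, x 6]"] shear_point_a shear_point_b)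
      (auto simp: comb_def algebra_simps upt_rec eval_nat_numeral)
  have flip_point_a: "zorn (vec [x 0, - x 2, x 1, x 3, x 5, - x 4, x 6]) (vec [y 0, - y 2, y 1, y 3, y 5, - y 4, y 6]) = [0, 0, 0, 0, 0, 0, 0, 0]"
    if "zorn x y = [0, 0, 0, 0, 0, 0, 0, 0]" for x y :: "nat \<Rightarrow> 'r"
  proof -
    have "zorn (vec [x 0, - x 2, x 1, x 3, x 5, - x 4, x 6]) (vec [y 0, - y 2, y 1, y 3, y 5, - y 4, y 6]) =
      (case zorn x y of [a, u1, u2, u3, v1, v2, v3, b] \<Rightarrow> [a, u1, - u3, u2, v1, - v3, v2, b])"
      by (simp add: zorn_def algebra_simps)
    then show ?thesis by (simp add: that)
  qed
  have flip_point_b: "zorn (vec [x 0, x 2, - x 1, x 3, - x 5, x 4, x 6]) (vec [y 0, y 2, - y 1, y 3, - y 5, y 4, y 6]) = [0, 0, 0, 0, 0, 0, 0, 0]"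
    if "zorn x y = [0, 0, 0, 0, 0, 0, 0, 0]" for x y :: "nat \<Rightarrow> 'r"
  proof -
    have "zorn (vec [x 0, x 2, - x 1, x 3, - x 5, x 4, x 6]) (vec [y 0, y 2, - y 1, y 3, - y 5, y 4, y 6]) =
      (case zorn x y of [a, u1, u2, u3, v1, v2, v3, b] \<Rightarrow> [a, u1, u3, - u2, v1, v3, - v2, b])"
      by (simp add: zorn_def algebra_simps)
    then show ?thesis by (simp add: that)
  qed
  have flip_point: "(\<lambda>x. vec [x 0, - x 2, x 1, x 3, x 5, - x 4, x 6]) \<in> auts"
    by (intro lin_aut[where G = "\<lambda>x. [x 0, - x 2, x 1, x 3, x 5, - x 4, x 6]" and H = "\<lambda>x. [x 0, x 2, - x 1, x 3, - x 5, x 4, x 6]" and h = "\<lambda>x. vec [x 0, x 2, - x 1, x 3, - x 5, x 4, x 6]"] flip_point_a flip_point_b)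
      (auto simp: comb_def algebra_simps upt_rec eval_nat_numeral)
  \<comment> \<open>A short root element of \<open>G2\<close>. The weight string through the middle
    coordinate consists of positions 2, 3, 4, whence the factor 2 and the quadratic term; they keep
    \<open>x 3 * x 3 + x 4 * x 2\<close> invariant.\<close>
  have shear_line_a: "zorn (vec [x 0, x 1 + t * x 0, x 2, x 3 - t * x 2, x 4 + 2 * (t * x 3) - t * t * x 2, x 5, x 6 - t * x 5]) (vec [y 0, y 1 + t * y 0, y 2, y 3 - t * y 2, y 4 + 2 * (t * y 3) - t * t * y 2, y 5, y 6 - t * y 5]) = [0, 0, 0, 0, 0, 0, 0, 0]"
    if "zorn x y = [0, 0, 0, 0, 0, 0, 0, 0]" for x y :: "nat \<Rightarrow> 'r" and t
  proof -
    have "zorn (vec [x 0, x 1 + t * x 0, x 2, x 3 - t * x 2, x 4 + 2 * (t * x 3) - t * t * x 2, x 5, x 6 - t * x 5]) (vec [y 0, y 1 + t * y 0, y 2, y 3 - t * y 2, y 4 + 2 * (t * y 3) - t * t * y 2, y 5, y 6 - t * y 5]) =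
      (case zorn x y of [a, u1, u2, u3, v1, v2, v3, b] \<Rightarrow> [a - t * v3, u1, u2, u3 + t * a - t * t * v3 - t * b, v1 - t * u2, v2 + t * u1, v3, b + t * v3])"
      by (simp add: zorn_def algebra_simps)
    then show ?thesis by (simp add: that)
  qed
  have shear_line_b: "zorn (vec [x 0, x 1 - t * x 0, x 2, x 3 + t * x 2, x 4 - 2 * (t * x 3) - t * t * x 2, x 5, x 6 + t * x 5]) (vec [y 0, y 1 - t * y 0, y 2, y 3 + t * y 2, y 4 - 2 * (t * y 3) - t * t * y 2, y 5, y 6 + t * y 5]) = [0, 0, 0, 0, 0, 0, 0, 0]"
    if "zorn x y = [0, 0, 0, 0, 0, 0, 0, 0]" for x y :: "nat \<Rightarrow> 'r" and t
  proof -
    have "zorn (vec [x 0, x 1 - t * x 0, x 2, x 3 + t * x 2, x 4 - 2 * (t * x 3) - t * t * x 2, x 5, x 6 + t * x 5]) (vec [y 0, y 1 - t * y 0, y 2, y 3 + t * y 2, y 4 - 2 * (t * y 3) - t * t * y 2, y 5, y 6 + t * y 5]) =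
      (case zorn x y of [a, u1, u2, u3, v1, v2, v3, b] \<Rightarrow> [a + t * v3, u1, u2, u3 - t * a - t * t * v3 + t * b, v1 + t * u2, v2 - t * u1, v3, b - t * v3])"
      by (simp add: zorn_def algebra_simps)
    then show ?thesis by (simp add: that)
  qed
  have shear_line: "(\<lambda>x. vec [x 0, x 1 + t * x 0, x 2, x 3 - t * x 2, x 4 + 2 * (t * x 3) - t * t * x 2, x 5, x 6 - t * x 5]) \<in> auts" if "t \<in> F" for t
    using that by (intro lin_aut[where G = "\<lambda>x. [x 0, x 1 + t * x 0, x 2, x 3 - t * x 2, x 4 + 2 * (t * x 3) - t * t * x 2, x 5, x 6 - t * x 5]" and H = "\<lambda>x. [x 0, x 1 - t * x 0, x 2, x 3 + t * x 2, x 4 - 2 * (t * x 3) - t * t * x 2, x 5, x 6 + t * x 5]" and h = "\<lambda>x. vec [x 0, x 1 - t * x 0, x 2, x 3 + t * x 2, x 4 - 2 * (t * x 3) - t * t * x 2, x 5, x 6 + t * x 5]"] shear_line_a shear_line_b)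
      (auto simp: comb_def algebra_simps upt_rec eval_nat_numeral)
  \<comment> \<open>This exchanges the diagonal entries and the two vectors of a Zorn matrix. The
    exchange reverses the sign of the cross products, and the simultaneous transposition of vector
    coordinates 1 and 2 restores it.\<close>
  have flip_line_a: "zorn (vec [x 1, x 0, x 4, - x 3, x 2, x 6, x 5]) (vec [y 1, y 0, y 4, - y 3, y 2, y 6, y 5]) = [0, 0, 0, 0, 0, 0, 0, 0]"
    if "zorn x y = [0, 0, 0, 0, 0, 0, 0, 0]" for x y :: "nat \<Rightarrow> 'r"
  proof -
    have "zorn (vec [x 1, x 0, x 4, - x 3, x 2, x 6, x 5]) (vec [y 1, y 0, y 4, - y 3, y 2, y 6, y 5]) =
      (case zorn x y of [a, u1, u2, u3, v1, v2, v3, b] \<Rightarrow> [b, v2, v1, v3, u2, u1, u3, a])"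
      by (simp add: zorn_def algebra_simps)
    then show ?thesis by (simp add: that)
  qed
  have flip_line_b: "zorn (vec [x 1, x 0, x 4, - x 3, x 2, x 6, x 5]) (vec [y 1, y 0, y 4, - y 3, y 2, y 6, y 5]) = [0, 0, 0, 0, 0, 0, 0, 0]"
    if "zorn x y = [0, 0, 0, 0, 0, 0, 0, 0]" for x y :: "nat \<Rightarrow> 'r"
  proof -
    have "zorn (vec [x 1, x 0, x 4, - x 3, x 2, x 6, x 5]) (vec [y 1, y 0, y 4, - y 3, y 2, y 6, y 5]) =
      (case zorn x y of [a, u1, u2, u3, v1, v2, v3, b] \<Rightarrow> [b, v2, v1, v3, u2, u1, u3, a])"
      by (simp add: zorn_def algebra_simps)
    then show ?thesis by (simp add: that)
  qed
  have flip_line: "(\<lambda>x. vec [x 1, x 0, x 4, - x 3, x 2, x 6, x 5]) \<in> auts"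
    by (intro lin_aut[where G = "\<lambda>x. [x 1, x 0, x 4, - x 3, x 2, x 6, x 5]" and H = "\<lambda>x. [x 1, x 0, x 4, - x 3, x 2, x 6, x 5]" and h = "\<lambda>x. vec [x 1, x 0, x 4, - x 3, x 2, x 6, x 5]"] flip_line_a flip_line_b)
      (auto simp: comb_def algebra_simps upt_rec eval_nat_numeral)
  have lt: "i = 0 \<or> i = 1 \<or> i = 2 \<or> i = 3 \<or> i = 4 \<or> i = 5 \<or> i = 6" if "i < 7" for i :: nat
    using that by auto
  \<comment> \<open>Squaring to zero rules out the weight-zero position as a leading one, so the
    entry 0 for position 3 in the list of places is a placeholder.\<close>
  have not3: "i \<noteq> 3" if x: "x \<in> V" "zorn x x = [0, 0, 0, 0, 0, 0, 0, 0]" "is_lead x i" for x i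
  proof
    assume i: "i = 3"
    have "x 4 = 0" "x 5 = 0" "x 6 = 0" using x(3) i by (auto simp: is_lead_def)
    then have "x 3 * x 3 = 0" using x(2) by (simp add: zorn_def)
    then show False using lead_mult_nz[OF x(1,1,3,3)] i by simp
  qed
  show ?thesis
  proof
    show "\<exists>g\<in>auts. g (bv 0) = bv 0 \<and> g (bv 1) = comb e (bv 1) t (bv 2)" if t: "t \<in> F" for t
      by (rule bexI[OF _ shear_point[OF t]]) (use t in \<open>auto simp: bv_def comb_def fun_eq_iff vec_def nth_Cons'\<close>)
    show "\<exists>g\<in>auts. g (bv 0) = bv 0 \<and> g (bv 1) = bv 2"
      by (rule bexI[OF _ flip_point]) (auto simp: bv_def fun_eq_iff vec_def nth_Cons')
    show "\<exists>g\<in>auts. g (bv 0) = comb e (bv 0) t (bv 1) \<and> g (bv 1) = bv 1" if t: "t \<in> F" for t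
      by (rule bexI[OF _ shear_line[OF t]]) (use t in \<open>auto simp: bv_def comb_def fun_eq_iff vec_def nth_Cons'\<close>)
    show "\<exists>g\<in>auts. g (bv 0) = bv 1 \<and> g (bv 1) = bv 0"
      by (rule bexI[OF _ flip_line]) (auto simp: bv_def fun_eq_iff vec_def nth_Cons')
    show "([0, 5, 1, 0, 4, 2, 3] ! i :: nat) + 1 = [0, 5, 1, 0, 4, 2, 3] ! j \<or>
        ([0, 5, 1, 0, 4, 2, 3] ! j :: nat) + 1 = [0, 5, 1, 0, 4, 2, 3] ! i"
      if xy: "x \<in> V" "y \<in> V" "zorn x x = [0, 0, 0, 0, 0, 0, 0, 0]" "zorn y y = [0, 0, 0, 0, 0, 0, 0, 0]"
        "zorn x y = [0, 0, 0, 0, 0, 0, 0, 0]" "is_lead x i" "is_lead y j" "i \<noteq> j" "{i, j} \<noteq> {0, 1}" for x y i j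
    proof -
      have ij: "i < 7" "j < 7" "i \<noteq> 3" "j \<noteq> 3" using lead_less not3 xy by auto
      have nz: "x i * y j \<noteq> 0" using lead_mult_nz xy by blast
      have 0: "i < k \<Longrightarrow> x k = 0" "j < k \<Longrightarrow> y k = 0" for k using xy(6,7) by (auto simp: is_lead_def)
      show ?thesis
        using lt[OF ij(1)] lt[OF ij(2)]
        by (elim disjE) (use ij(3,4) xy(5,8,9) nz in \<open>simp_all add: zorn_def 0 insert_commute mult.commute\<close>)
    qed
    show "zorn x y = [0, 0, 0, 0, 0, 0, 0, 0]" if "x \<in> L0" "y \<in> L0" for x y
      using that by (auto simp: L0_def span2_def comb_def bv_def zorn_def)
    show "w i = 0" if w: "w \<in> V" "zorn (bv 0) w = [0, 0, 0, 0, 0, 0, 0, 0]" "3 \<le> i" for w i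
    proof (cases "i < 7")
      case True
      then have "i = 3 \<or> i = 4 \<or> i = 5 \<or> i = 6" using w(3) by auto
      then show ?thesis using w(2) V_F[OF w(1)] by (elim disjE) (simp_all add: zorn_def bv_def)
    next
      case False
      then show ?thesis using V_0[OF w(1), of i] by simp
    qed
    \<comment> \<open>Singular vectors lie on the quadric given by the first entry of
      \<open>zorn x x\<close>. For a leading position \<open>i \<ge> 4\<close> the coordinate
      \<open>6 - i\<close> is left out of the list: it is multiplied by \<open>x i = e\<close> in
      the equation and so is determined by the others.\<close>
    have "card {x \<in> V. zorn x x = [0, 0, 0, 0, 0, 0, 0, 0] \<and> (\<exists>i. is_lead x i \<and> x i = e)}
        \<le> (\<Sum>i\<in>{0, 1, 2, 4, 5, 6}. card F ^ card (set ([[], [0], [0, 1], [], [0, 1, 3], [0, 2, 3, 4], [1, 2, 3, 4, 5]] ! i :: nat list)))"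
    proof (rule card_normalised_le)
      fix x i assume "x \<in> {x \<in> V. zorn x x = [0, 0, 0, 0, 0, 0, 0, 0] \<and> (\<exists>i. is_lead x i \<and> x i = e)}"
        "is_lead x i"
      then show "i \<in> {0, 1, 2, 4, 5, 6}" using not3[of x i] lead_less[of x i] lt[of i] by auto
    next
      fix x y i
      assume x: "x \<in> {x \<in> V. zorn x x = [0, 0, 0, 0, 0, 0, 0, 0] \<and> (\<exists>i. is_lead x i \<and> x i = e)}" "is_lead x i"
        and y: "y \<in> {x \<in> V. zorn x x = [0, 0, 0, 0, 0, 0, 0, 0] \<and> (\<exists>i. is_lead x i \<and> x i = e)}" "is_lead y i"
        and eq: "\<And>j. j \<in> set ([[], [0], [0, 1], [], [0, 1, 3], [0, 2, 3, 4], [1, 2, 3, 4, 5]] ! i :: nat list) \<Longrightarrow> x j = y j"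
      have e: "x i = e" "y i = e" using x y is_lead_unique by blast+
      have V: "x \<in> V" "y \<in> V" using x y by auto
      have 0: "i < k \<Longrightarrow> x k = 0" "i < k \<Longrightarrow> y k = 0" for k using x(2) y(2) by (auto simp: is_lead_def)
      have q: "x 3 * x 3 + x 0 * x 6 + x 5 * x 1 + x 4 * x 2 = 0"
        "y 3 * y 3 + y 0 * y 6 + y 5 * y 1 + y 4 * y 2 = 0"
        using x(1) y(1) by (auto simp: zorn_def)
      have "i = 0 \<or> i = 1 \<or> i = 2 \<or> i = 4 \<or> i = 5 \<or> i = 6"
        using not3[of x i] lead_less[of x i] lt[of i] x by auto
      then have "x 0 = y 0 \<and> x 1 = y 1 \<and> x 2 = y 2 \<and> x 3 = y 3 \<and> x 4 = y 4 \<and> x 5 = y 5 \<and> x 6 = y 6"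
        by (elim disjE) (use q e eq V_F[OF V(1)] V_F[OF V(2)] in \<open>simp_all add: 0 add_eq_0_iff\<close>)
      then show "x = y" using lt by (intro vec_eqI[OF V]) auto
    qed auto
    also have "\<dots> = 1 + card F + card F ^ 2 + card F ^ 3 + card F ^ 4 + card F ^ 5" by (simp add: eval_nat_numeral)
    finally show "card {x \<in> V. zorn x x = [0, 0, 0, 0, 0, 0, 0, 0] \<and> (\<exists>i. is_lead x i \<and> x i = e)}
        \<le> 1 + card F + card F ^ 2 + card F ^ 3 + card F ^ 4 + card F ^ 5" .
  qed auto
qed

end

theorem theorem1p3:
  fixes \<delta> :: nat
  assumes "\<delta> \<ge> 2" and "primepow (\<delta> - 1)"
  shows "(\<exists>n :: nat \<Rightarrow> nat. filterlim n at_top sequentially \<and>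
            (\<forall>i. radii (n i) \<delta> 6 \<noteq> {} \<and>
              real (max_radius (n i) \<delta> 6)
                \<ge> 3 * real (n i) / (2 * (real \<delta> ^ 2 - real \<delta> + 1)) - 3)) \<and>
         (\<exists>n :: nat \<Rightarrow> nat. filterlim n at_top sequentially \<and>
            (\<forall>j. radii (n j) \<delta> 8 \<noteq> {} \<and>
              real (max_radius (n j) \<delta> 8)
                \<ge> 2 * real (n j) / (real \<delta> ^ 3 - 2 * real \<delta> ^ 2 + 2 * real \<delta>) - 4)) \<and>
         (\<exists>n :: nat \<Rightarrow> nat. filterlim n at_top sequentially \<and>
            (\<forall>k. radii (n k) \<delta> 12 \<noteq> {} \<and>
              real (max_radius (n k) \<delta> 12)
                \<ge> 3 * real (n k) / (((real \<delta> - 1) ^ 3 + 1) * (real \<delta> ^ 2 - real \<delta> + 1)) - 6))"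
proof -
  define q where "q = \<delta> - 1"
  have \<delta>: "\<delta> = q + 1" using assms(1) by (simp add: q_def)
  obtain F and e :: galois_product where F: "corner_field F e" and card: "card F = q"
    using exists_corner_field assms(2) unfolding q_def by blast
  \<comment> \<open>The ratio \<open>d / (2 * M)\<close> reduces for \<open>d = 4\<close> and
    \<open>d = 6\<close>, which explains why only the first bound keeps a factor 2 in its
    denominator.\<close>
  have halve: "real 4 * x / (2 * m) - real 4 = 2 * x / m - 4"
    "real 6 * x / (2 * m) - real 6 = 3 * x / m - 6" for x m :: real
    by simp_all
  have "real (1 + q + q ^ 2) = real \<delta> ^ 2 - real \<delta> + 1"
    by (simp add: \<delta> power2_eq_square algebra_simps)
  then have plane: "real 3 * x / (2 * real (1 + q + q ^ 2)) - real 3 =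
      3 * x / (2 * (real \<delta> ^ 2 - real \<delta> + 1)) - 3" for x
    by (simp only: of_nat_numeral)
  \<comment> \<open>Both sides are \<open>(1 + q) * (1 + q ^ 2)\<close> with
    \<open>q = \<delta> - 1\<close>.\<close>
  have "real (1 + q + q ^ 2 + q ^ 3) = real \<delta> ^ 3 - 2 * real \<delta> ^ 2 + 2 * real \<delta>"
    by (simp add: \<delta> power2_eq_square power3_eq_cube algebra_simps)
  then have quadrangle: "real 4 * x / (2 * real (1 + q + q ^ 2 + q ^ 3)) - real 4 =
      2 * x / (real \<delta> ^ 3 - 2 * real \<delta> ^ 2 + 2 * real \<delta>) - 4" for x
    unfolding halve by simp
  \<comment> \<open>The factorisation \<open>(1 + q ^ 3) * (1 + q + q ^ 2)\<close>, rewritten in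
    \<open>\<delta>\<close>.\<close>
  have "real (1 + q + q ^ 2 + q ^ 3 + q ^ 4 + q ^ 5) =
      ((real \<delta> - 1) ^ 3 + 1) * (real \<delta> ^ 2 - real \<delta> + 1)"
    by (simp add: \<delta> eval_nat_numeral algebra_simps)
  then have hexagon: "real 6 * x / (2 * real (1 + q + q ^ 2 + q ^ 3 + q ^ 4 + q ^ 5)) - real 6 =
      3 * x / (((real \<delta> - 1) ^ 3 + 1) * (real \<delta> ^ 2 - real \<delta> + 1)) - 6" for x
    unfolding halve by simp
  have double: "2 * 3 = (6 :: nat)" "2 * 4 = (8 :: nat)" "2 * 6 = (12 :: nat)" by simp_all
  show ?thesis
    using polygon_geometry.polygon_radius_family[OF corner_field.projective_plane[OF F]]
      polygon_geometry.polygon_radius_family[OF corner_field.symplectic_quadrangle[OF F]]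
      polygon_geometry.polygon_radius_family[OF corner_field.split_cayley_hexagon[OF F]]
    unfolding card \<delta>[symmetric] double plane quadrangle hexagon by blast
qed

end
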